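(* Let $k\ge 0$ be an integer and let $L\ge 1$ be real, and let $S=\mathbb{R}/L\mathbb{Z}$. If $S=A_1\cup\dots\cup A_{k+1}$ is a partition of $S$ into $k+1$ pairwise disjoint Lebesgue measurable sets, then \[ \Phi(A_1)+\Phi(A_2)+\dots+\Phi(A_{k+1})\ge (\sqrt{k^2+1}-k)L . \]
   Context: $S=\mathbb{R}/L\mathbb{Z}$ is the circle of circumference $L$ with its Lebesgue measure $\lambda$. For $x\in S$ and $t\in\mathbb{R}$, $x+t$ denotes addition in $S$. For a measurable set $A\subseteq S$, $\Phi(A)$ denotes the (two-dimensional Lebesgue) measure of the set $\{(x,t)\in A\times[0,1]\colon x+t\in A\}$; equivalently, $\Phi(A)$ is the measure of the set of pairs $(x,y)\in A^2$ with $x\le y\le x+1$, where $y$ is reached from $x$ by moving forward along the circle by a distance in $[0,1]$ (pairs "wrapping around" the circle are included). *)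

theory Defs
  imports "HOL-Analysis.Analysis" "HOL-Library.Real_Mod"
begin

(* The circle R/LZ (for L > 0) is represented by its fundamental domain [0,L): a class is
   identified with its unique representative there, and its Lebesgue measure is the one
   inherited from the real line. *)

definition circle :: "real \<Rightarrow> real set" where
  "circle L = {0..<L}"

(* x + t in R/LZ, for x in the circle and t real *)
definition circle_add :: "real \<Rightarrow> real \<Rightarrow> real \<Rightarrow> real" where
  "circle_add L x t = (x + t) rmod L"

(* The Lebesgue measure on real \<times> real is used instead of the product measure
   lebesgue \<Otimes>\<^sub>M lebesgue because the latter is not complete: for A Lebesgue but not Borel
   measurable, the set below need not belong to the product sigma-algebra. It always is
   Lebesgue measurable in the plane, and it is bounded, so that measure does not degenerate. *)
definition Phi :: "real \<Rightarrow> real set \<Rightarrow> real" where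
  "Phi L A = measure lebesgue {(x, t). x \<in> A \<and> t \<in> {0..1} \<and> circle_add L x t \<in> A}"

end

theory Submission
  imports Defs
begin

text \<open>
  It suffices to bound a single class from below, by
  \<open>\<Phi>(A) \<ge> c \<bar>A\<bar> - (1 - s) (L - \<bar>A\<bar>)\<close> with \<open>c = 1/r\<close>, \<open>s = k/r\<close> and \<open>r = sqrt (k\<^sup>2 + 1)\<close>: these
  bounds add up to the claim. With \<open>\<alpha> = 1 - c\<close> and \<open>\<beta> = 1 - s\<close> one has
  \<open>(1 - \<alpha> - \<beta>)\<^sup>2 = 2 \<alpha> \<beta>\<close>, and the bound says that the pairs \<open>(x, x + t)\<close> with \<open>x \<in> A\<close>,
  \<open>x + t \<notin> A\<close> and \<open>0 \<le> t \<le> 1\<close> have measure at most \<open>\<alpha> \<bar>A\<bar> + \<beta> (L - \<bar>A\<bar>)\<close>.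

  For cyclic two-coloured words and pairs at distance at most \<open>w\<close>, take a counterexample with
  \<open>w + n\<close> minimal, \<open>n\<close> being the length. Minimality in \<open>w\<close> shows that there are many bichromatic
  pairs at distance exactly \<open>w\<close>. Minimality in \<open>n\<close>, applied to the deletion of a letter next to a
  colour change, shows that every window of length \<open>w\<close> ending at a colour change contains (up to a
  bounded error) at least \<open>\<beta> w\<close> positions \<open>z\<close> with \<open>z, z + w\<close> both in \<open>A\<close> and at least \<open>\<alpha> w\<close>
  with both outside \<open>A\<close>. A greedy selection of colour changes puts every position into at most two
  such windows and every \<open>z\<close> whose colour differs from that of \<open>z + w\<close> into at least one. Counting over a
  period contradicts \<open>(1 - \<alpha> - \<beta>)\<^sup>2 \<le> 2 \<alpha> \<beta>\<close>. The error depends on the number of colour changes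
  only, so it disappears when each letter is repeated many times. Finally, the count is affine in each letter
  separately, so letters may be replaced by the densities of \<open>A\<close> in short arcs.
\<close>

section \<open>Cyclic words\<close>

definition periodic :: "int \<Rightarrow> (int \<Rightarrow> 'a) \<Rightarrow> bool" where
  "periodic n f \<longleftrightarrow> (\<forall>x. f (x + n) = f x)"

definition num :: "int \<Rightarrow> (int \<Rightarrow> bool) \<Rightarrow> real" where
  "num n f = (\<Sum>z\<in>{0..<n}. of_bool (f z))"

text \<open>Discrete counterpart of the pairs that \<open>Phi\<close> misses: steps of length at
  most \<open>w\<close> that leave the class. The reach \<open>w\<close> may exceed the period, and
  then endpoints count repeatedly.\<close>

definition cut :: "int \<Rightarrow> int \<Rightarrow> (int \<Rightarrow> bool) \<Rightarrow> real" where
  "cut n w u = (\<Sum>j\<in>{1..w}. num n (\<lambda>x. u x \<and> \<not> u (x + j)))"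

text \<open>A colour change is placed at the first position of the new colour, so \<open>u\<close>
  and its complement have the same corners.\<close>

definition corner :: "(int \<Rightarrow> bool) \<Rightarrow> int \<Rightarrow> bool" where
  "corner u e \<longleftrightarrow> u (e - 1) \<noteq> u e"

lemma periodic_mult:
  assumes "periodic n f"
  shows "f (x + k * n) = f x"
proof (induction k rule: int_induct[where k = 0])
  case (step1 i)
  have "f (x + (i + 1) * n) = f ((x + i * n) + n)" by (simp add: algebra_simps)
  with step1 assms show ?case by (simp add: periodic_def)
next
  case (step2 i)
  have "f (x + (i - 1) * n) = f ((x + (i - 1) * n) + n)" using assms by (simp add: periodic_def)
  with step2 show ?case by (simp add: algebra_simps)
qed simp

lemma sum_periodic:
  fixes g :: "int \<Rightarrow> real"
  assumes "periodic n g" "n \<ge> 0"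
  shows "(\<Sum>z\<in>{a..<a+n}. g z) = (\<Sum>z\<in>{0..<n}. g z)"
proof -
  have step: "(\<Sum>z\<in>{a+1..<a+1+n}. g z) = (\<Sum>z\<in>{a..<a+n}. g z)" for a
  proof -
    have "(\<Sum>z\<in>{a..<a+n+1}. g z) = (\<Sum>z\<in>{a..<a+n}. g z) + g (a + n)"
    proof -
      have "{a..<a+n+1} = insert (a+n) {a..<a+n}" using assms(2) by auto
      thus ?thesis by simp
    qed
    moreover have "(\<Sum>z\<in>{a..<a+n+1}. g z) = g a + (\<Sum>z\<in>{a+1..<a+n+1}. g z)"
    proof -
      have "{a..<a+n+1} = insert a {a+1..<a+n+1}" using assms(2) by auto
      thus ?thesis by simp
    qed
    ultimately show ?thesis using assms(1) by (simp add: periodic_def algebra_simps)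
  qed
  show ?thesis
  proof (induction a rule: int_induct[where k = 0])
    case (step1 i) thus ?case using step[of i] by simp
  next
    case (step2 i) thus ?case using step[of "i - 1"] by simp
  qed simp
qed

lemma num_shift:
  assumes "periodic n f" "n \<ge> 0"
  shows "num n (\<lambda>x. f (x + a)) = num n f"
proof -
  have "num n (\<lambda>x. f (x + a)) = (\<Sum>z\<in>{a..<a+n}. of_bool (f z))"
    unfolding num_def
    by (rule sum.reindex_bij_witness[of _ "\<lambda>z. z - a" "\<lambda>z. z + a"]) auto
  also have "\<dots> = num n f"
    unfolding num_def using assms by (intro sum_periodic) (auto simp: periodic_def)
  finally show ?thesis .
qed

lemma num_nonneg: "num n f \<ge> 0"
  by (simp add: num_def sum_nonneg)

lemma num_conj_split: "num n f = num n (\<lambda>x. f x \<and> g x) + num n (\<lambda>x. f x \<and> \<not> g x)"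
  unfolding num_def sum.distrib[symmetric] by (intro sum.cong) auto

lemma num_compl:
  assumes "n \<ge> 0" shows "num n (\<lambda>x. \<not> f x) = of_int n - num n f"
proof -
  have "num n f + num n (\<lambda>x. \<not> f x) = (\<Sum>z\<in>{0..<n}. 1)"
    unfolding num_def sum.distrib[symmetric] by (intro sum.cong) auto
  thus ?thesis using assms by simp
qed

lemma periodic_compl: "periodic n u \<Longrightarrow> periodic n (\<lambda>x. \<not> u x)"
  by (auto simp: periodic_def)

lemma periodic_shift: "periodic n u \<Longrightarrow> periodic n (\<lambda>x. u (x + a))"
  unfolding periodic_def by (metis add.commute add.left_commute)

text \<open>Around a cycle, steps of a fixed length enter the class as often as they leave it. This
  makes \<open>cut\<close> symmetric under complement.\<close>

lemma num_diff_compl: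
  assumes "periodic n u" "n \<ge> 0"
  shows "num n (\<lambda>x. \<not> u x \<and> u (x + j)) = num n (\<lambda>x. u x \<and> \<not> u (x + j))"
proof -
  have "num n (\<lambda>x. u (x + j)) = num n u" using assms by (rule num_shift)
  moreover have "num n (\<lambda>x. u (x + j)) = num n (\<lambda>x. u (x + j) \<and> u x) + num n (\<lambda>x. u (x + j) \<and> \<not> u x)"
    by (rule num_conj_split)
  moreover have "num n u = num n (\<lambda>x. u x \<and> u (x + j)) + num n (\<lambda>x. u x \<and> \<not> u (x + j))"
    by (rule num_conj_split)
  ultimately show ?thesis by (simp add: conj_commute)
qed

lemma cut_compl:
  assumes "periodic n u" "n \<ge> 0"
  shows "cut n w (\<lambda>x. \<not> u x) = cut n w u"
  unfolding cut_def using num_diff_compl[OF assms] by simp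

lemma cut_shift:
  assumes "periodic n u" "n \<ge> 0"
  shows "cut n w (\<lambda>x. u (x + a)) = cut n w u"
  unfolding cut_def
proof (intro sum.cong refl)
  fix j
  have "periodic n (\<lambda>x. u x \<and> \<not> u (x + j))"
    using assms(1) periodic_shift[OF assms(1), of j] by (auto simp: periodic_def)
  from num_shift[OF this assms(2), of a]
  show "num n (\<lambda>x. u (x + a) \<and> \<not> u (x + j + a)) = num n (\<lambda>x. u x \<and> \<not> u (x + j))"
    by (simp add: add_ac)
qed

lemma cut_swap: "cut n w u = (\<Sum>x\<in>{0..<n}. \<Sum>j\<in>{1..w}. of_bool (u x \<and> \<not> u (x + j)))"
  unfolding cut_def num_def by (rule sum.swap)

lemma cut_Suc:
  assumes "w \<ge> 1"
  shows "cut n w u = cut n (w - 1) u + num n (\<lambda>x. u x \<and> \<not> u (x + w))"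
proof -
  have "{1..w} = insert w {1..w-1}" using assms by auto
  thus ?thesis by (simp add: cut_def)
qed

section \<open>Deleting a letter from a cyclic word\<close>

text \<open>Only steps across the deleted position \<open>n - 1\<close> change. From such a start
  \<open>x\<close> inside \<open>u\<close>, the shortened word trades the endpoint
  \<open>n - 1\<close>, which lies outside \<open>u\<close>, for \<open>x + w + 1\<close>; an exit
  is lost exactly when the latter lies inside \<open>u\<close>.\<close>

lemma cut_delete:
  fixes n w :: int
  assumes u: "periodic n u" and nu: "\<not> u (n - 1)" and w: "1 \<le> w" "w < n"
  defines "v \<equiv> \<lambda>x. u (x mod (n - 1))"
  shows "cut n w u \<le> cut (n - 1) w v + (\<Sum>x\<in>{n-1-w..<n-1}. of_bool (u x \<and> u (x + w + 1)))"
proof -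
  define m where "m = n - 1"
  have m: "m \<ge> 1" "w \<le> m" using w by (auto simp: m_def)
  have v1: "v x = u x" if "0 \<le> x" "x < m" for x
    using that by (simp add: v_def m_def)
  \<comment> \<open>Past the deletion the shortened word runs one letter ahead of \<open>u\<close>.
    As \<open>w \<le> m\<close>, no step from \<open>{0..<m}\<close> leaves this range.\<close>
  have v2: "v x = u (x + 1)" if "m \<le> x" "x < 2 * m" for x
  proof -
    have "x mod m = (x - m) mod m" by simp
    also have "\<dots> = x - m" using that by (intro mod_pos_pos_trivial) auto
    finally have "v x = u (x - m)" by (simp add: v_def m_def)
    also have "\<dots> = u (x - m + n)" using u by (simp add: periodic_def)
    finally show ?thesis by (simp add: m_def)
  qed
  have inner: "(\<Sum>j\<in>{1..w}. of_bool (u x \<and> \<not> u (x + j)))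
      \<le> (\<Sum>j\<in>{1..w}. of_bool (v x \<and> \<not> v (x + j))) + (of_bool (x \<ge> m - w \<and> u x \<and> u (x + w + 1)) :: real)"
    if x: "0 \<le> x" "x < m" for x
  proof (cases "u x \<and> x + w \<ge> m")
    case False
    have "(\<Sum>j\<in>{1..w}. of_bool (u x \<and> \<not> u (x + j))) = (\<Sum>j\<in>{1..w}. of_bool (v x \<and> \<not> v (x + j)) :: real)"
      using False x v1 by (intro sum.cong) auto
    thus ?thesis by simp
  next
    case True
    hence ux: "u x" and vx: "v x" using v1 x by auto
    have I: "{1..w} = {1..<m-x} \<union> {m-x..w}" using x True by auto
    have split: "(\<Sum>j\<in>{1..w}. f j) = (\<Sum>j\<in>{1..<m-x}. f j) + (\<Sum>j\<in>{m-x..w}. f j)" for f :: "int \<Rightarrow> real"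
      unfolding I by (rule sum.union_disjoint) auto
    have A: "(\<Sum>j\<in>{1..<m-x}. of_bool (\<not> u (x + j))) = (\<Sum>j\<in>{1..<m-x}. of_bool (\<not> v (x + j)) :: real)"
      using x v1 by (intro sum.cong) auto
    have "(\<Sum>j\<in>{m-x..w}. of_bool (\<not> v (x + j)) :: real) = (\<Sum>j\<in>{m-x..w}. of_bool (\<not> u (x + j + 1)))"
      using x m v2 by (intro sum.cong) auto
    also have "\<dots> = (\<Sum>j\<in>{m-x+1..w+1}. of_bool (\<not> u (x + j)))"
      by (rule sum.reindex_bij_witness[of _ "\<lambda>z. z - 1" "\<lambda>z. z + 1"]) (auto simp: add_ac)
    finally have B: "(\<Sum>j\<in>{m-x..w}. of_bool (\<not> v (x + j)) :: real) = (\<Sum>j\<in>{m-x+1..w+1}. of_bool (\<not> u (x + j)))" .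
    \<comment> \<open>The index ranges for \<open>u\<close> and \<open>v\<close> differ only at
      their two ends inside \<open>{m-x..w+1}\<close>: the deleted letter and the newly reached
      one.\<close>
    have "{m-x..w+1} = insert (m-x) {m-x+1..w+1}" "{m-x..w+1} = insert (w+1) {m-x..w}" using True by auto
    hence "of_bool (\<not> u (x + (m - x))) + (\<Sum>j\<in>{m-x+1..w+1}. of_bool (\<not> u (x + j)))
        = (of_bool (\<not> u (x + (w + 1))) + (\<Sum>j\<in>{m-x..w}. of_bool (\<not> u (x + j))) :: real)"
      by (metis (mono_tags, lifting) add_left_cancel atLeastAtMost_iff finite_atLeastAtMost_int less_add_one
            linorder_not_less sum.insert)
    moreover have "\<not> u (x + (m - x))" using nu by (simp add: m_def)
    ultimately have "(\<Sum>j\<in>{m-x..w}. of_bool (\<not> u (x + j)) :: real)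
        = (\<Sum>j\<in>{m-x..w}. of_bool (\<not> v (x + j))) + of_bool (u (x + w + 1))"
      using B by (auto simp: add_ac of_bool_def)
    thus ?thesis using True ux vx by (simp add: split A)
  qed
  have "{0..<n} = insert m {0..<m}" using m by (auto simp: m_def)
  hence "cut n w u = (\<Sum>x\<in>{0..<m}. \<Sum>j\<in>{1..w}. of_bool (u x \<and> \<not> u (x + j)))"
    using nu by (simp add: cut_swap m_def)
  also have "\<dots> \<le> (\<Sum>x\<in>{0..<m}. (\<Sum>j\<in>{1..w}. of_bool (v x \<and> \<not> v (x + j))) + of_bool (x \<ge> m - w \<and> u x \<and> u (x + w + 1)))"
    using inner by (intro sum_mono) auto
  also have "\<dots> = cut m w v + (\<Sum>x\<in>{0..<m}. of_bool (x \<ge> m - w \<and> u x \<and> u (x + w + 1)))"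
    by (simp add: cut_swap sum.distrib)
  also have "(\<Sum>x\<in>{0..<m}. of_bool (x \<ge> m - w \<and> u x \<and> u (x + w + 1)) :: real)
      = (\<Sum>x\<in>{m-w..<m}. of_bool (u x \<and> u (x + w + 1)))"
    using m by (intro sum.mono_neutral_cong_right) auto
  finally show ?thesis by (simp add: m_def)
qed

lemma num_delete:
  fixes n :: int
  assumes "n \<ge> 1"
  shows "num (n - 1) (\<lambda>x. u (x mod (n - 1))) = num n u - of_bool (u (n - 1))"
proof -
  have "{0..<n} = insert (n - 1) {0..<n-1}" using assms by auto
  thus ?thesis by (simp add: num_def)
qed

text \<open>Deletion fuses two neighbouring boundaries into one, which is a colour change only if
  one of the two was. Hence a bound on colour changes can be carried through the induction on the
  length.\<close>

lemma corner_delete: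
  fixes n :: int
  assumes u: "periodic n u" and n: "n \<ge> 2"
  defines "v \<equiv> \<lambda>x. u (x mod (n - 1))"
  shows "num (n - 1) (corner v) \<le> num n (corner u)"
proof -
  \<comment> \<open>In the shortened word the predecessor of position 0 is
    \<open>n - 2\<close>.\<close>
  have "-1 mod (n - 1) = (-1 + (n - 1)) mod (n - 1)" by (rule mod_add_self2[symmetric])
  also have "\<dots> = n - 2" using n by (subst mod_pos_pos_trivial) auto
  finally have m1: "-1 mod (n - 1) = n - 2" .
  have "{0..<n-1} = insert 0 {1..<n-1}" using n by auto
  hence 1: "num (n - 1) (corner v) = of_bool (corner v 0) + (\<Sum>z\<in>{1..<n-1}. of_bool (corner v z))"
    by (simp add: num_def)
  have 2: "(\<Sum>z\<in>{1..<n-1}. of_bool (corner v z)) = (\<Sum>z\<in>{1..<n-1}. of_bool (corner u z) :: real)"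
    by (intro sum.cong) (auto simp: corner_def v_def)
  have "{0..<n} = insert 0 (insert (n-1) {1..<n-1})" using n by auto
  hence 3: "num n (corner u) = of_bool (corner u 0) + of_bool (corner u (n - 1)) + (\<Sum>z\<in>{1..<n-1}. of_bool (corner u z))"
    using n by (simp add: num_def)
  have "u (n - 1) = u (-1)" using u by (metis add.commute periodic_def uminus_add_conv_diff)
  hence "of_bool (corner v 0) \<le> (of_bool (corner u 0) + of_bool (corner u (n - 1)) :: real)"
    using m1 by (auto simp: corner_def v_def)
  with 1 2 3 show ?thesis by simp
qed

section \<open>Greedy chains of colour changes\<close>

lemma num_add:
  assumes "0 \<le> a" "a \<le> b"
  shows "num b f = num a f + (\<Sum>z\<in>{a..<b}. of_bool (f z))"
proof -
  have "{0..<b} = {0..<a} \<union> {a..<b}" using assms by auto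
  moreover have "{0..<a} \<inter> {a..<b} = {}" by auto
  ultimately show ?thesis by (simp add: num_def sum.union_disjoint del: sum_of_bool_eq)
qed

lemma num_mono: "a \<le> b \<Longrightarrow> num a f \<le> num b f"
  unfolding num_def by (intro sum_mono2) auto

lemma num_add_period:
  assumes "periodic n f" "0 \<le> n" "0 \<le> x"
  shows "num (x + int t * n) f = num x f + real t * num n f"
proof (induction t)
  case (Suc t)
  have per: "periodic n (\<lambda>z. of_bool (f z) :: real)" using assms(1) by (auto simp: periodic_def)
  have "num (x + int t * n + n) f = num (x + int t * n) f + (\<Sum>z\<in>{x + int t * n..<x + int t * n + n}. of_bool (f z))"
    using assms by (intro num_add) auto
  also have "(\<Sum>z\<in>{x + int t * n..<x + int t * n + n}. of_bool (f z) :: real) = num n f"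
    unfolding num_def by (rule sum_periodic[OF per assms(2)])
  finally show ?case using Suc by (simp add: algebra_simps)
qed simp

text \<open>Greedy rule: the farthest colour change within reach \<open>w\<close>, or the nearest
  one beyond if there is none. Searching up to \<open>e + n\<close> then suffices, since a period of
  a nonconstant word contains a colour change.\<close>

definition next_corner :: "int \<Rightarrow> int \<Rightarrow> (int \<Rightarrow> bool) \<Rightarrow> int \<Rightarrow> int" where
  "next_corner n w u e = (if \<exists>x\<in>{e<..e+w}. corner u x
     then Max {x\<in>{e<..e+w}. corner u x} else Min {x\<in>{e<..e+n}. corner u x})"

lemma corner_periodic: "periodic n u \<Longrightarrow> periodic n (corner u)"
  using periodic_shift[of n u "-1"] by (auto simp: periodic_def corner_def)

lemma corner_window_shift:
  assumes "periodic n u"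
  shows "{x\<in>{e + k * n<..e + k * n + w}. corner u x} = (\<lambda>x. x + k * n) ` {x\<in>{e<..e+w}. corner u x}"
proof -
  have c: "corner u (x + k * n) = corner u x" for x
    by (rule periodic_mult[OF corner_periodic[OF assms]])
  show ?thesis
  proof (intro set_eqI iffI)
    fix x assume "x \<in> {x\<in>{e + k * n<..e + k * n + w}. corner u x}"
    moreover have "corner u (x - k * n) = corner u x" using c[of "x - k * n"] by simp
    ultimately have "x - k * n \<in> {x\<in>{e<..e+w}. corner u x}" by auto
    thus "x \<in> (\<lambda>x. x + k * n) ` {x\<in>{e<..e+w}. corner u x}"
      by (intro image_eqI[of _ _ "x - k * n"]) auto
  qed (auto simp: c)
qed

lemma corner_between:
  assumes "a < b" "u a \<noteq> u b"
  shows "\<exists>x\<in>{a<..b}. corner u x"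
proof (rule ccontr)
  assume H: "\<not> ?thesis"
  have "a \<le> x \<Longrightarrow> x \<le> b \<longrightarrow> u x = u a" for x
  proof (induction x rule: int_ge_induct)
    case (step x) 
    show ?case
    proof
      assume "x + 1 \<le> b"
      with H step.hyps have "\<not> corner u (x + 1)" by auto
      thus "u (x + 1) = u a" using step \<open>x + 1 \<le> b\<close> by (auto simp: corner_def)
    qed
  qed simp
  from this[of b] assms show False by auto
qed

context
  fixes n w :: int and u :: "int \<Rightarrow> bool"
  assumes per: "periodic n u" and n: "0 < n" and ex: "\<exists>c. corner u c"
begin

lemma corner_in_period: "{x\<in>{e<..e+n}. corner u x} \<noteq> {}"
proof -
  obtain c where c: "corner u c" using ex by blast
  \<comment> \<open>The translate of \<open>c\<close> by a multiple of \<open>n\<close> that falls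
    into the half-open period after \<open>e\<close>.\<close>
  define x where "x = e + 1 + (c - (e + 1)) mod n"
  have "x = c + (- ((c - (e + 1)) div n)) * n"
    unfolding x_def by (simp add: minus_div_mult_eq_mod [symmetric] algebra_simps)
  hence "corner u x" using c periodic_mult[OF corner_periodic[OF per]] by metis
  moreover have "x \<in> {e<..e+n}" using n by (auto simp: x_def pos_mod_bound add_strict_increasing
        intro: order.strict_trans2) (smt (verit) pos_mod_bound)
  ultimately show ?thesis by blast
qed

text \<open>The greedy rule commutes with full turns, so the chain can be closed up modulo
  \<open>n\<close>.\<close>

lemma next_corner_shift: "next_corner n w u (e + k * n) = next_corner n w u e + k * n"
proof -
  have mono: "mono (\<lambda>x. x + k * n)" by (auto simp: mono_def)
  have M: "Max ((\<lambda>x. x + k * n) ` S) = Max S + k * n" "Min ((\<lambda>x. x + k * n) ` S) = Min S + k * n"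
    if "finite S" "S \<noteq> {}" for S
    using mono_Max_commute[OF mono that] mono_Min_commute[OF mono that] by auto
  have E: "(\<exists>x\<in>{a<..b}. corner u x) \<longleftrightarrow> {x\<in>{a<..b}. corner u x} \<noteq> {}" for a b by auto
  have f: "finite {x\<in>{a<..b}. corner u x}" for a b :: int by (rule finite_subset[of _ "{a<..b}"]) auto
  show ?thesis
  proof (cases "{x\<in>{e<..e+w}. corner u x} = {}")
    case True
    show ?thesis unfolding next_corner_def E corner_window_shift[OF per]
      by (simp only: True image_empty simp_thms if_False M(2)[OF f corner_in_period])
  next
    case False
    show ?thesis unfolding next_corner_def E corner_window_shift[OF per]
      by (simp only: False image_is_empty simp_thms if_True M(1)[OF f False])
  qed
qed

text \<open>Two greedy steps pass \<open>e + w\<close>, since otherwise the first would not have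
  reached the farthest colour change. In the last claim the next corner must lie beyond
  \<open>e + w\<close>, hence is the nearest one, and no colour change separates \<open>z\<close>
  from \<open>z + w\<close>.\<close>

lemma next_corner_props:
  shows "corner u (next_corner n w u e)" "e < next_corner n w u e"
    and "e + w < next_corner n w u (next_corner n w u e)"
    and "\<And>z. \<lbrakk>w > 0; e \<le> z; z + w < next_corner n w u e\<rbrakk> \<Longrightarrow> u z = u (z + w)"
proof -
  let ?f = "next_corner n w u"
  have A: "?f e \<in> {x\<in>{e<..e+w}. corner u x} \<and> (\<forall>x\<in>{e<..e+w}. corner u x \<longrightarrow> x \<le> ?f e)"
    if "\<exists>x\<in>{e<..e+w}. corner u x" for e
  proof -
    have "finite {x\<in>{e<..e+w}. corner u x}" by (rule finite_subset[of _ "{e<..e+w}"]) auto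
    moreover have "{x\<in>{e<..e+w}. corner u x} \<noteq> {}" using that by auto
    ultimately have "finite {x\<in>{e<..e+w}. corner u x}" "{x\<in>{e<..e+w}. corner u x} \<noteq> {}" by auto
    from Max_in[OF this] Max_ge[OF this(1)] that show ?thesis by (auto simp: next_corner_def)
  qed
  have B: "?f e \<in> {x\<in>{e<..e+n}. corner u x} \<and> (\<forall>x\<in>{e<..<?f e}. \<not> corner u x) \<and> ?f e > e + w"
    if H: "\<not> (\<exists>x\<in>{e<..e+w}. corner u x)" for e
  proof -
    have fin: "finite {x\<in>{e<..e+n}. corner u x}" by (rule finite_subset[of _ "{e<..e+n}"]) auto
    have eq: "?f e = Min {x\<in>{e<..e+n}. corner u x}" using H by (simp add: next_corner_def)
    have 1: "?f e \<in> {x\<in>{e<..e+n}. corner u x}"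
      using Min_in[OF fin corner_in_period] eq by simp
    have 2: "\<not> corner u x" if x: "x \<in> {e<..<?f e}" for x
    proof
      assume "corner u x"
      with x 1 have "x \<in> {x\<in>{e<..e+n}. corner u x}" by auto
      from Min_le[OF fin this] eq x show False by auto
    qed
    from 1 2 H show ?thesis by fastforce
  qed
  have AB: "corner u (?f e) \<and> e < ?f e" for e using A[of e] B[of e] by fastforce
  thus "corner u (?f e)" "e < ?f e" by auto
  show "e + w < ?f (?f e)"
  proof (cases "\<exists>x\<in>{e<..e+w}. corner u x")
    case True
    show ?thesis
    proof (rule ccontr)
      assume "\<not> ?thesis"
      with AB[of e] AB[of "?f e"] have "?f (?f e) \<in> {e<..e+w}" "corner u (?f (?f e))" by auto
      with A[OF True] AB[of "?f e"] show False by fastforce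
    qed
  next
    case False
    from B[OF this] AB[of "?f e"] show ?thesis by auto
  qed
  fix z assume w: "w > 0" and z: "e \<le> z" "z + w < ?f e"
  show "u z = u (z + w)"
  proof (rule ccontr)
    assume "u z \<noteq> u (z + w)"
    hence "\<exists>x\<in>{z<..z+w}. corner u x" using w by (intro corner_between) auto
    then obtain x where x: "x \<in> {z<..z+w}" "corner u x" by blast
    show False
    proof (cases "\<exists>x\<in>{e<..e+w}. corner u x")
      case True
      from A[OF this] z show False by auto
    next
      case False
      from B[OF this] x z show False by auto
    qed
  qed
qed

text \<open>By pigeonhole two members of the greedy chain agree modulo \<open>n\<close>; their
  successors then agree as well. Between them the chain makes \<open>t\<close> full turns.\<close>

lemma corner_orbit:
  obtains e :: "nat \<Rightarrow> int" and i j t :: nat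
  where "i < j" "t > 0" "e 0 \<ge> w" "\<And>k. corner u (e k)" "\<And>k. e k < e (Suc k)"
    "\<And>k. e k + w < e (Suc (Suc k))"
    "\<And>k z. \<lbrakk>w > 0; e k \<le> z; z + w < e (Suc k)\<rbrakk> \<Longrightarrow> u z = u (z + w)"
    "e j = e i + int t * n" "e (Suc j) = e (Suc i) + int t * n"
proof -
  \<comment> \<open>The extra iteration makes already \<open>e 0\<close> a colour change. Starting
    from \<open>w\<close> keeps all windows \<open>{e k - w..<e k}\<close> among the nonnegative
    positions, where \<open>num\<close> can count them.\<close>
  define e where "e k = (next_corner n w u ^^ Suc k) w" for k
  have Suc: "e (Suc k) = next_corner n w u (e k)" for k by (simp add: e_def)
  have lt: "e k < e (Suc k)" for k unfolding Suc by (rule next_corner_props)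
  have "\<not> inj (\<lambda>k. e k mod n)"
  proof
    assume "inj (\<lambda>k. e k mod n)"
    moreover have "range (\<lambda>k. e k mod n) \<subseteq> {0..<n}" using n by auto
    ultimately show False using finite_subset finite_atLeastLessThan_int range_inj_infinite by metis
  qed
  then obtain i j where ij: "e i mod n = e j mod n" "i < j" unfolding inj_def by (metis linorder_neqE_nat)
  have "strict_mono e" using lt by (simp add: strict_mono_Suc_iff)
  hence "e i < e j" using ij by (simp add: strict_mono_less)
  define d where "d = (e j - e i) div n"
  have d: "e j = e i + d * n"
    using ij(1) by (metis add.commute add_diff_cancel_left' d_def dvd_div_mult_self mod_eq_dvd_iff diff_add_cancel)
  hence "d * n > 0" using \<open>e i < e j\<close> by auto
  hence "d > 0" using n by (simp add: zero_less_mult_iff)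
  define t where "t = nat d"
  show thesis
  proof (rule that[of i j t e])
    show "e j = e i + int t * n" using d \<open>d > 0\<close> by (simp add: t_def)
    thus "e (Suc j) = e (Suc i) + int t * n" unfolding Suc by (simp add: next_corner_shift)
    show "corner u (e k)" for k
      unfolding e_def funpow.simps o_def by (rule next_corner_props)
    show "e k + w < e (Suc (Suc k))" for k unfolding Suc by (rule next_corner_props)
    show "u z = u (z + w)" if "w > 0" "e k \<le> z" "z + w < e (Suc k)" for k z
      using next_corner_props(4)[of "e k" z] that by (simp add: Suc)
    show "w \<le> e 0" using next_corner_props(2)[of w] by (simp add: e_def)
  qed (use ij \<open>d > 0\<close> lt in \<open>auto simp: t_def\<close>)
qed

end

text \<open>
  Both estimates telescope along the chain \<open>e\<close>: the window ending at \<open>e (k + 2)\<close> starts after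
  \<open>e k\<close>, and positions from \<open>e k\<close> up to the start of the window ending at \<open>e (k + 1)\<close> have the same
  colour as their translates by \<open>w\<close>.
\<close>

lemma corner_counts:
  fixes n w :: int
  assumes per: "periodic n u" and w: "0 < w" and n: "0 < n" and ex: "\<exists>c. corner u c"
    and P: "\<And>e. corner u e \<Longrightarrow> P \<le> (\<Sum>z\<in>{e-w..<e}. of_bool (u z \<and> u (z + w)))"
    and Q: "\<And>e. corner u e \<Longrightarrow> Q \<le> (\<Sum>z\<in>{e-w..<e}. of_bool (\<not> u z \<and> \<not> u (z + w)))"
  obtains N :: real where "N > 0"
    "N * P \<le> num n (\<lambda>z. u z \<and> u (z + w))"
    "N * Q \<le> num n (\<lambda>z. \<not> u z \<and> \<not> u (z + w))"
    "num n (\<lambda>z. u z \<and> \<not> u (z + w)) \<le> N * (of_int w - P - Q)"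
proof -
  obtain e i j t where ij: "i < j" and t: "t > 0" and e0: "e (0::nat) \<ge> w" and c: "\<And>k. corner u (e k)"
    and lt: "\<And>k. e k < e (Suc k)" and ee: "\<And>k. e k + w < e (Suc (Suc k))"
    and eq: "\<And>k z. \<lbrakk>w > 0; e k \<le> z; z + w < e (Suc k)\<rbrakk> \<Longrightarrow> u z = u (z + w)"
    and close: "e j = e i + int t * n" "e (Suc j) = e (Suc i) + int t * n"
    using corner_orbit[OF per n ex, of w] by metis
  have "strict_mono e" using lt by (simp add: strict_mono_Suc_iff)
  hence ew: "e k \<ge> w" for k using e0 by (meson le0 order_trans strict_mono_less_eq)
  have win: "(\<Sum>z\<in>{e k-w..<e k}. of_bool (f z)) = num (e k) f - num (e k - w) f" for f k
    using num_add[of "e k - w" "e k" f] ew[of k] w by simp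
  have tele: "(\<Sum>k\<in>{i..<j}. g (Suc k) - g k) = g j - g i" for g :: "nat \<Rightarrow> real"
    using ij by (simp add: sum_Suc_diff')
  \<comment> \<open>The factor 2 arises because windows two apart in the chain are disjoint, so
    \<open>t\<close> turns cover each position at most twice.\<close>
  have upper: "real (j - i) * X \<le> 2 * real t * num n f"
    if X: "\<And>k. X \<le> (\<Sum>z\<in>{e k-w..<e k}. of_bool (f z))" and f: "periodic n f" for X f
  proof -
    have "real (j - i) * X = (\<Sum>k\<in>{i..<j}. X)" by simp
    also have "\<dots> \<le> (\<Sum>k\<in>{i..<j}. num (e (Suc (Suc k))) f - num (e k) f)"
    proof (rule sum_mono)
      fix k
      have "X \<le> num (e (Suc (Suc k))) f - num (e (Suc (Suc k)) - w) f" using X win by metis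
      moreover have "num (e k) f \<le> num (e (Suc (Suc k)) - w) f" using ee[of k] by (intro num_mono) auto
      ultimately show "X \<le> num (e (Suc (Suc k))) f - num (e k) f" by simp
    qed
    also have "\<dots> = (\<Sum>k\<in>{i..<j}. num (e (Suc (Suc k))) f - num (e (Suc k)) f) + (\<Sum>k\<in>{i..<j}. num (e (Suc k)) f - num (e k) f)"
      by (simp add: sum.distrib[symmetric])
    also have "\<dots> = (num (e (Suc j)) f - num (e (Suc i)) f) + (num (e j) f - num (e i) f)"
      using tele[of "\<lambda>k. num (e (Suc k)) f"] tele[of "\<lambda>k. num (e k) f"] by simp
    also have "\<dots> = 2 * real t * num n f"
      unfolding close using n ew w by (subst (1 2) num_add_period[OF f]) (auto intro: order.strict_implies_order order_trans)
    finally show ?thesis .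
  qed
  \<comment> \<open>Half the average number of chain members per turn. The half fits both the double
    covering in \<open>upper\<close> and the two directions of bichromatic pairs below.\<close>
  define N where "N = real (j - i) / (2 * real t)"
  have per2: "periodic n (\<lambda>z. u (z + w))" using per by (rule periodic_shift)
  show thesis
  proof (rule that[of N])
    show "N > 0" using ij t by (simp add: N_def)
    show "N * P \<le> num n (\<lambda>z. u z \<and> u (z + w))"
      using upper[of P "\<lambda>z. u z \<and> u (z + w)"] P c per per2 t
      by (simp add: N_def field_simps periodic_def)
    show "N * Q \<le> num n (\<lambda>z. \<not> u z \<and> \<not> u (z + w))"
      using upper[of Q "\<lambda>z. \<not> u z \<and> \<not> u (z + w)"] Q c per per2 t
      by (simp add: N_def field_simps periodic_def)
    let ?d = "\<lambda>z. u z \<noteq> u (z + w)"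
    have pd: "periodic n ?d" using per per2 by (simp add: periodic_def)
    have "real t * num n ?d = num (e j) ?d - num (e i) ?d"
      unfolding close(1) using n ew[of i] w by (subst num_add_period[OF pd]) auto
    also have "\<dots> = (\<Sum>k\<in>{i..<j}. num (e (Suc k)) ?d - num (e k) ?d)"
      using tele[of "\<lambda>k. num (e k) ?d"] by simp
    also have "\<dots> \<le> (\<Sum>k\<in>{i..<j}. of_int w - P - Q)"
    proof (rule sum_mono)
      fix k
      let ?I = "{e (Suc k) - w..<e (Suc k)}"
      \<comment> \<open>Positions between \<open>e k\<close> and the start of the next window carry
        no bichromatic pair, so each chain step is charged to its window alone.\<close>
      have "num (e (Suc k) - w) ?d \<le> num (e k) ?d"
      proof (cases "e (Suc k) - w \<le> e k")
        case True thus ?thesis by (rule num_mono)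
      next
        case False
        have "(\<Sum>z\<in>{e k..<e (Suc k) - w}. of_bool (?d z) :: real) = 0"
          using eq[OF w, of k] by (intro sum.neutral) auto
        with num_add[of "e k" "e (Suc k) - w" ?d] False ew[of k] w show ?thesis by simp
      qed
      hence "num (e (Suc k)) ?d - num (e k) ?d \<le> (\<Sum>z\<in>?I. of_bool (?d z))"
        unfolding win by simp
      also have "\<dots> = (\<Sum>z\<in>?I. 1 - of_bool (u z \<and> u (z + w)) - of_bool (\<not> u z \<and> \<not> u (z + w)))"
        by (intro sum.cong) auto
      also have "\<dots> = of_int w - (\<Sum>z\<in>?I. of_bool (u z \<and> u (z + w))) - (\<Sum>z\<in>?I. of_bool (\<not> u z \<and> \<not> u (z + w)))"
        using w by (simp add: sum_subtractf)
      also have "\<dots> \<le> of_int w - P - Q" using P[OF c[of "Suc k"]] Q[OF c[of "Suc k"]] by linarith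
      finally show "num (e (Suc k)) ?d - num (e k) ?d \<le> of_int w - P - Q" .
    qed
    finally have "real t * num n ?d \<le> real (j - i) * (of_int w - P - Q)" by simp
    moreover have "num n ?d = 2 * num n (\<lambda>z. u z \<and> \<not> u (z + w))"
    proof -
      have "num n ?d = num n (\<lambda>z. ?d z \<and> u z) + num n (\<lambda>z. ?d z \<and> \<not> u z)" by (rule num_conj_split)
      also have "(\<lambda>z. ?d z \<and> u z) = (\<lambda>z. u z \<and> \<not> u (z + w))" by auto
      also have "(\<lambda>z. ?d z \<and> \<not> u z) = (\<lambda>z. \<not> u z \<and> u (z + w))" by auto
      finally show ?thesis using num_diff_compl[OF per, of w] n by simp
    qed
    ultimately show "num n (\<lambda>z. u z \<and> \<not> u (z + w)) \<le> N * (of_int w - P - Q)"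
      using t by (simp add: N_def field_simps)
  qed
qed

section \<open>The discrete inequality\<close>

text \<open>Deleting a letter outside \<open>u\<close> lowers the bound by
  \<open>M * \<beta>\<close>. As the shorter word obeys its bound and \<open>u\<close> violates its
  own, the loss term of \<open>cut_delete\<close> must be at least that large.\<close>

lemma cut_deletion_bound:
  fixes n w y :: int and \<alpha> \<beta> M :: real
  assumes per: "periodic n u" and w: "1 \<le> w" "w < n"
    and big: "cut n w u > M * (\<alpha> * num n u + \<beta> * num n (\<lambda>x. \<not> u x))"
    and IH: "\<And>v. periodic (n - 1) v \<Longrightarrow> num (n - 1) (corner v) \<le> num n (corner u)
      \<Longrightarrow> cut (n - 1) w v \<le> M * (\<alpha> * num (n - 1) v + \<beta> * num (n - 1) (\<lambda>x. \<not> v x))"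
    and y: "\<not> u y"
  shows "M * \<beta> \<le> (\<Sum>z\<in>{y-w..<y}. of_bool (u z \<and> u (z + w + 1)))"
proof -
  \<comment> \<open>Rotation that brings \<open>y\<close> to the last position, where
    \<open>cut_delete\<close> removes it.\<close>
  define u' where "u' = (\<lambda>x. u (x + (y - (n - 1))))"
  define v where "v = (\<lambda>x. u' (x mod (n - 1)))"
  have n: "n \<ge> 2" using w by auto
  have per': "periodic n u'" unfolding u'_def by (rule periodic_shift[OF per])
  have y': "\<not> u' (n - 1)" using y by (simp add: u'_def)
  have perv: "periodic (n - 1) v" by (simp add: periodic_def v_def)
  have num': "num n u' = num n u" "num n (\<lambda>x. \<not> u' x) = num n (\<lambda>x. \<not> u x)"
    unfolding u'_def using num_shift[OF per] num_shift[OF periodic_compl[OF per]] n by auto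
  have "corner (\<lambda>x. u (x + a)) = (\<lambda>x. corner u (x + a))" for a
    by (simp add: corner_def fun_eq_iff algebra_simps)
  hence "num n (corner u') = num n (\<lambda>x. corner u (x + (y - (n - 1))))"
    by (simp add: u'_def)
  also have "\<dots> = num n (corner u)" using n by (intro num_shift corner_periodic per) auto
  finally have c: "num (n - 1) (corner v) \<le> num n (corner u)"
    using corner_delete[OF per' n] by (simp add: v_def)
  have nv: "num (n - 1) v = num n u" "num (n - 1) (\<lambda>x. \<not> v x) = num n (\<lambda>x. \<not> u x) - 1"
    using num_delete[of n u'] num_delete[of n "\<lambda>x. \<not> u' x"] n y' by (auto simp: v_def num')
  have "M * (\<alpha> * num n u + \<beta> * num n (\<lambda>x. \<not> u x)) < cut n w u'"
    using big cut_shift[OF per, of w "y - (n - 1)"] n by (simp add: u'_def)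
  also have "\<dots> \<le> cut (n - 1) w v + (\<Sum>x\<in>{n-1-w..<n-1}. of_bool (u' x \<and> u' (x + w + 1)))"
    unfolding v_def by (rule cut_delete[OF per' y' w])
  also have "cut (n - 1) w v \<le> M * (\<alpha> * num n u + \<beta> * (num n (\<lambda>x. \<not> u x) - 1))"
    using IH[OF perv c] by (simp add: nv)
  also have "(\<Sum>x\<in>{n-1-w..<n-1}. of_bool (u' x \<and> u' (x + w + 1))) =
      (\<Sum>z\<in>{y-w..<y}. of_bool (u z \<and> u (z + w + 1)) :: real)"
    unfolding u'_def
    by (rule sum.reindex_bij_witness[of _ "\<lambda>z. z - (y - (n - 1))" "\<lambda>z. z + (y - (n - 1))"]) (auto simp: algebra_simps)
  finally show ?thesis by (simp add: algebra_simps)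
qed

lemma sum_window_le_num:
  assumes "periodic n f" "0 \<le> w" "w \<le> n"
  shows "(\<Sum>z\<in>{a..<a+w}. of_bool (f z)) \<le> num n f"
proof -
  have "(\<Sum>z\<in>{a..<a+w}. of_bool (f z) :: real) \<le> (\<Sum>z\<in>{a..<a+n}. of_bool (f z))"
    using assms by (intro sum_mono2) auto
  also have "\<dots> = num n f" unfolding num_def
    using assms by (intro sum_periodic) (auto simp: periodic_def)
  finally show ?thesis .
qed

text \<open>
  Deleting a letter compares pairs at distance \<open>w + 1\<close>, whereas the counting argument needs
  distance \<open>w\<close>; the number of colour changes bounds the discrepancy.
\<close>

lemma corner_window_bound:
  assumes per: "periodic n u" and w: "1 \<le> w" "w < n" and e: "corner u e"
    and B: "\<And>y. \<not> u y \<Longrightarrow> X \<le> (\<Sum>z\<in>{y-w..<y}. of_bool (u z \<and> u (z + w + 1)))"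
  shows "X \<le> (\<Sum>z\<in>{e-w..<e}. of_bool (u z \<and> u (z + w))) + num n (corner u)"
proof (cases "u e")
  \<comment> \<open>The letter outside \<open>u\<close> at the colour change is \<open>e\<close> or
    \<open>e - 1\<close>. In the first case the far end of the pair is off by one, in the second the
    near end; each pair that goes wrong crosses its own colour change.\<close>
  case False
  note B[OF False]
  also have "(\<Sum>z\<in>{e-w..<e}. of_bool (u z \<and> u (z + w + 1)) :: real)
      \<le> (\<Sum>z\<in>{e-w..<e}. of_bool (u z \<and> u (z + w)) + of_bool (corner u (z + w + 1)))"
    by (intro sum_mono) (auto simp: corner_def)
  also have "\<dots> = (\<Sum>z\<in>{e-w..<e}. of_bool (u z \<and> u (z + w))) + (\<Sum>z\<in>{e-w..<e}. of_bool (corner u (z + w + 1)))"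
    by (rule sum.distrib)
  also have "(\<Sum>z\<in>{e-w..<e}. of_bool (corner u (z + w + 1)) :: real) = (\<Sum>z\<in>{e+1..<e+1+w}. of_bool (corner u z))"
    by (rule sum.reindex_bij_witness[of _ "\<lambda>z. z - w - 1" "\<lambda>z. z + w + 1"]) auto
  also have "\<dots> \<le> num n (corner u)" using w by (intro sum_window_le_num corner_periodic per) auto
  finally show ?thesis by simp
next
  case True
  hence "\<not> u (e - 1)" using e by (auto simp: corner_def)
  note B[OF this]
  also have "(\<Sum>z\<in>{e-1-w..<e-1}. of_bool (u z \<and> u (z + w + 1)) :: real)
      = (\<Sum>z\<in>{e-w..<e}. of_bool (u (z - 1) \<and> u (z + w)))"
    by (rule sum.reindex_bij_witness[of _ "\<lambda>z. z - 1" "\<lambda>z. z + 1"]) (auto simp: add_ac)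
  also have "\<dots> \<le> (\<Sum>z\<in>{e-w..<e}. of_bool (u z \<and> u (z + w)) + of_bool (corner u z))"
    by (intro sum_mono) (auto simp: corner_def)
  also have "\<dots> = (\<Sum>z\<in>{e-w..<e}. of_bool (u z \<and> u (z + w))) + (\<Sum>z\<in>{e-w..<e-w+w}. of_bool (corner u z))"
    by (simp add: sum.distrib)
  also have "(\<Sum>z\<in>{e-w..<e-w+w}. of_bool (corner u z) :: real) \<le> num n (corner u)" 
    using w by (intro sum_window_le_num corner_periodic per) auto
  finally show ?thesis by simp
qed

text \<open>The last \<open>n\<close> distances lead from each start once around the cycle and so
  meet every letter outside \<open>u\<close> exactly once.\<close>

lemma cut_add_period:
  assumes per: "periodic n u" and n: "n \<ge> 0" and w: "w \<ge> n"
  shows "cut n w u = cut n (w - n) u + num n u * num n (\<lambda>x. \<not> u x)"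
proof -
  define g where "g j = num n (\<lambda>x. u x \<and> \<not> u (x + j))" for j
  have "{1..w} = {1..w-n} \<union> {w-n+1..<w-n+1+n}" using n w by auto
  moreover have "{1..w-n} \<inter> {w-n+1..<w-n+1+n} = {}" by auto
  ultimately have "cut n w u = cut n (w - n) u + (\<Sum>j\<in>{w-n+1..<w-n+1+n}. g j)"
    unfolding cut_def g_def[symmetric] by (simp add: sum.union_disjoint)
  also have "periodic n g"
    using per by (simp add: periodic_def g_def add.assoc[symmetric])
  hence "(\<Sum>j\<in>{w-n+1..<w-n+1+n}. g j) = (\<Sum>j\<in>{0..<n}. g j)" using n by (rule sum_periodic)
  also have "\<dots> = (\<Sum>x\<in>{0..<n}. \<Sum>j\<in>{0..<n}. of_bool (u x \<and> \<not> u (x + j)))"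
    unfolding g_def num_def by (rule sum.swap)
  also have "\<dots> = (\<Sum>x\<in>{0..<n}. of_bool (u x) * num n (\<lambda>x. \<not> u x))"
  proof (rule sum.cong[OF refl])
    fix x
    have "(\<Sum>j\<in>{0..<n}. of_bool (u x \<and> \<not> u (x + j))) = of_bool (u x) * num n (\<lambda>j. \<not> u (j + x))"
      unfolding num_def sum_distrib_left by (intro sum.cong) (auto simp: add_ac)
    thus "(\<Sum>j\<in>{0..<n}. of_bool (u x \<and> \<not> u (x + j))) = of_bool (u x) * num n (\<lambda>x. \<not> u x)"
      using num_shift[OF periodic_compl[OF per] n] by simp
  qed
  finally show ?thesis by (simp add: num_def[of n u] sum_distrib_right)
qed

text \<open>The slack \<open>C\<close> in the factor \<open>w + C\<close> absorbs the error of at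
  most \<open>K\<close> colour changes in each window estimate; \<open>K\<close> stays fixed during
  the induction on \<open>w + n\<close>.\<close>

lemma cut_bound_corners:
  fixes \<alpha> \<beta> C K :: real
  assumes pos: "\<alpha> > 0" "\<beta> > 0" and le: "\<alpha> + \<beta> \<le> 1" and quad: "(1 - \<alpha> - \<beta>)\<^sup>2 \<le> 2 * \<alpha> * \<beta>"
    and C: "K \<le> C * \<alpha>" "K \<le> C * \<beta>" "C \<ge> 0"
  shows "\<lbrakk>periodic n u; n \<ge> 1; w \<ge> 0; num n (corner u) \<le> K\<rbrakk>
    \<Longrightarrow> cut n w u \<le> (of_int w + C) * (\<alpha> * num n u + \<beta> * num n (\<lambda>x. \<not> u x))"
proof (induction "nat (w + n)" arbitrary: w n u rule: less_induct)
  case less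
  note per = less.prems(1) and n = less.prems(2) and w = less.prems(3) and K = less.prems(4)
  let ?a = "num n u" and ?b = "num n (\<lambda>x. \<not> u x)"
  let ?t = "\<alpha> * ?a + \<beta> * ?b"
  have ab: "?a \<ge> 0" "?b \<ge> 0" "?a + ?b = of_int n"
    using num_nonneg[of n u] num_nonneg[of n "\<lambda>x. \<not> u x"] num_compl[of n u] n by auto
  have t: "?t \<ge> 0" using ab pos by simp
  consider "w = 0" | "w \<ge> n" | "1 \<le> w" "w < n" using w by linarith
  thus ?case
  proof cases
    case 1
    thus ?thesis using t C by (simp add: cut_def)
  next
    case 2
    have "cut n (w - n) u \<le> (of_int (w - n) + C) * ?t"
      using less.hyps[of "w - n" n u] less.prems 2 by simp
    \<comment> \<open>Expanding \<open>?a + ?b = n\<close> reduces this to \<open>(1 - \<alpha> -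
      \<beta>) * ?a * ?b \<le> \<alpha> * ?a\<^sup>2 + \<beta> * ?b\<^sup>2\<close>, which follows
      from \<open>quad\<close> and \<open>2 * X * Y \<le> (X + Y)\<^sup>2\<close>.\<close>
    moreover have "?a * ?b \<le> of_int n * ?t"
    proof -
      have "(1 - \<alpha> - \<beta>)\<^sup>2 * (?a * ?b)\<^sup>2 \<le> (2 * \<alpha> * \<beta>) * (?a * ?b)\<^sup>2"
        using quad by (intro mult_right_mono) auto
      also have "\<dots> \<le> (2 * (\<alpha> * ?a\<^sup>2) * (\<beta> * ?b\<^sup>2))"
        by (simp add: power2_eq_square algebra_simps)
      also have "\<dots> \<le> (\<alpha> * ?a\<^sup>2 + \<beta> * ?b\<^sup>2)\<^sup>2"
        using pos by (simp add: power2_sum)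
      finally have "((1 - \<alpha> - \<beta>) * (?a * ?b))\<^sup>2 \<le> (\<alpha> * ?a\<^sup>2 + \<beta> * ?b\<^sup>2)\<^sup>2"
        by (simp add: power_mult_distrib)
      hence "(1 - \<alpha> - \<beta>) * (?a * ?b) \<le> \<alpha> * ?a\<^sup>2 + \<beta> * ?b\<^sup>2"
        by (rule power2_le_imp_le) (use pos in auto)
      thus ?thesis unfolding ab(3)[symmetric] by (simp add: power2_eq_square algebra_simps)
    qed
    ultimately show ?thesis using cut_add_period[OF per _ 2] n by (simp add: algebra_simps)
  next
    case 3
    show ?thesis
    proof (rule ccontr)
      assume "\<not> ?thesis"
      hence big: "cut n w u > (of_int w + C) * ?t" by simp
      let ?D = "num n (\<lambda>z. u z \<and> \<not> u (z + w))"
      let ?p = "num n (\<lambda>z. u z \<and> u (z + w))"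
      let ?q = "num n (\<lambda>z. \<not> u z \<and> \<not> u (z + w))"
      have "cut n (w - 1) u \<le> (of_int (w - 1) + C) * ?t"
        using less.hyps[of "w - 1" n u] less.prems 3 by simp
      \<comment> \<open>From \<open>w - 1\<close> to \<open>w\<close> the bound grows by exactly
        \<open>?t\<close>, so distance \<open>w\<close> alone contributes more than that.\<close>
      with big cut_Suc[OF 3(1), of n u] have Dt: "?D > ?t" by (simp add: algebra_simps)
      \<comment> \<open>Here \<open>C * \<gamma>\<close> pays for the colour changes.\<close>
      have Apos: "X \<le> Y" if "(of_int w + C) * \<gamma> \<le> Y + num n (corner u)" "K \<le> C * \<gamma>" "X = of_int w * \<gamma>" for X Y \<gamma> :: real
        using that K by (simp add: algebra_simps)
      have IH: "cut (n - 1) w v \<le> (of_int w + C) * (\<alpha> * num (n - 1) v + \<beta> * num (n - 1) (\<lambda>x. \<not> v x))"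
        if "periodic (n - 1) v" "num (n - 1) (corner v) \<le> num n (corner u)" for v
        using less.hyps[of w "n - 1" v] that 3 K by simp
      have P: "of_int w * \<beta> \<le> (\<Sum>z\<in>{e-w..<e}. of_bool (u z \<and> u (z + w)))" if e: "corner u e" for e
      proof -
        have "(of_int w + C) * \<beta> \<le> (\<Sum>z\<in>{e-w..<e}. of_bool (u z \<and> u (z + w))) + num n (corner u)"
          using cut_deletion_bound[OF per 3 big IH] by (intro corner_window_bound[OF per 3 e]) auto
        thus ?thesis using C(2) by (rule Apos) simp
      qed
      have Q: "of_int w * \<alpha> \<le> (\<Sum>z\<in>{e-w..<e}. of_bool (\<not> u z \<and> \<not> u (z + w)))" if e: "corner u e" for e
      proof -
        \<comment> \<open>The complement violates the bound with \<open>\<alpha>\<close> and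
          \<open>\<beta>\<close> exchanged, so the argument for \<open>P\<close> applies to
          it.\<close>
        let ?u = "\<lambda>x. \<not> u x"
        have per': "periodic n ?u" by (rule periodic_compl[OF per])
        have cc: "corner (\<lambda>x. \<not> v x) = corner v" for v by (auto simp: corner_def fun_eq_iff)
        have e': "corner ?u e" using e by (simp add: cc)
        have big': "cut n w ?u > (of_int w + C) * (\<beta> * num n ?u + \<alpha> * num n (\<lambda>x. \<not> ?u x))"
          using big n by (simp add: cut_compl[OF per] add.commute)
        have IH': "cut (n - 1) w v \<le> (of_int w + C) * (\<beta> * num (n - 1) v + \<alpha> * num (n - 1) (\<lambda>x. \<not> v x))"
          if "periodic (n - 1) v" "num (n - 1) (corner v) \<le> num n (corner ?u)" for v
          using IH[OF periodic_compl[OF that(1)]] that(2) n by (simp add: cc cut_compl[OF that(1)] add.commute)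
        have "(of_int w + C) * \<alpha> \<le> (\<Sum>z\<in>{e-w..<e}. of_bool (?u z \<and> ?u (z + w))) + num n (corner ?u)"
          using cut_deletion_bound[OF per' 3 big' IH'] by (intro corner_window_bound[OF per' 3 e']) auto
        thus ?thesis unfolding cc using C(1) by (rule Apos) simp
      qed
      have ex: "\<exists>c. corner u c"
      proof (rule ccontr)
        assume no: "\<not> ?thesis"
        have "\<not> (u z \<and> \<not> u (z + w))" for z
          using corner_between[of z "z + w" u] 3 no by auto
        hence "?D = 0" unfolding num_def by (intro sum.neutral) auto
        with Dt t show False by simp
      qed
      have pos': "0 < w" "0 < n" using 3 by auto
      obtain N where N: "N > 0" "N * (of_int w * \<beta>) \<le> ?p" "N * (of_int w * \<alpha>) \<le> ?q"
        "?D \<le> N * (of_int w - of_int w * \<beta> - of_int w * \<alpha>)"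
        by (rule corner_counts[OF per pos' ex P Q])
      \<comment> \<open>Splitting \<open>?a\<close> and \<open>?b\<close> into
        \<open>?p + ?D\<close> and \<open>?q + ?D\<close> in \<open>?D > ?t\<close> leaves
        \<open>?D\<close> with coefficient \<open>r\<close>. The bounds through \<open>N\<close>
        then give \<open>2 * \<alpha> * \<beta> < r\<^sup>2\<close>.\<close>
      define r where "r = 1 - \<alpha> - \<beta>"
      have r: "r \<ge> 0" using le by (simp add: r_def)
      have a: "?a = ?p + ?D" by (rule num_conj_split)
      have b: "?b = ?q + ?D"
      proof -
        have "?b = num n (\<lambda>z. \<not> u z \<and> u (z + w)) + ?q" by (rule num_conj_split)
        thus ?thesis using num_diff_compl[OF per, of w] n by simp
      qed
      have "r * ?D > \<alpha> * ?p + \<beta> * ?q" using Dt unfolding a b by (simp add: r_def algebra_simps)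
      moreover have "\<alpha> * ?p + \<beta> * ?q \<ge> \<alpha> * (N * (of_int w * \<beta>)) + \<beta> * (N * (of_int w * \<alpha>))"
        using N pos by (intro add_mono mult_left_mono) auto
      moreover have "r * ?D \<le> r * (N * (of_int w * r))"
        using N(4) r by (intro mult_left_mono) (auto simp: r_def algebra_simps)
      ultimately have "N * of_int w * (2 * \<alpha> * \<beta>) < N * of_int w * r\<^sup>2"
        by (simp add: algebra_simps power2_eq_square)
      moreover have "N * of_int w > 0" using N(1) 3 by simp
      ultimately have "2 * \<alpha> * \<beta> < r\<^sup>2" by (simp only: mult_less_cancel_left_pos)
      thus False using quad by (simp add: r_def)
    qed
  qed
qed

section \<open>Blow-ups: repeating each letter \<open>g\<close> times\<close>

lemma sum_div:
  fixes g n :: int and f :: "int \<Rightarrow> real"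
  assumes "g > 0"
  shows "(\<Sum>x\<in>{0..<g*n}. f (x div g)) = of_int g * (\<Sum>y\<in>{0..<n}. f y)"
proof -
  have "(\<Sum>x\<in>{0..<g*n}. f (x div g)) = (\<Sum>(y,r)\<in>{0..<n}\<times>{0..<g}. f y)"
  proof (rule sum.reindex_bij_witness[of _ "\<lambda>(y,r). g * y + r" "\<lambda>x. (x div g, x mod g)"])
    fix x assume x: "x \<in> {0..<g*n}"
    have "x div g < n"
    proof (rule ccontr)
      assume "\<not> x div g < n"
      hence "g * n \<le> g * (x div g)" using assms by (intro mult_left_mono) auto
      also have "\<dots> \<le> x" using assms mult_div_mod_eq[of g x] pos_mod_sign[of g x] by linarith
      finally show False using x by simp
    qed
    thus "(x div g, x mod g) \<in> {0..<n}\<times>{0..<g}" using x assms by (auto simp: pos_imp_zdiv_nonneg_iff)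
  next
    fix p assume p: "p \<in> {0..<n}\<times>{0..<g}"
    then obtain y r where yr: "p = (y, r)" "0 \<le> y" "y + 1 \<le> n" "0 \<le> r" "r < g" by force
    have "g * y + r < g * (y + 1)" using yr by (simp add: algebra_simps)
    also have "\<dots> \<le> g * n" using yr assms by (intro mult_left_mono) auto
    finally show "(case p of (y,r) \<Rightarrow> g * y + r) \<in> {0..<g*n}" using yr assms by auto
  qed (use assms in auto)
  also have "\<dots> = (\<Sum>y\<in>{0..<n}. \<Sum>r\<in>{0..<g}. f y)"
    by (rule sum.cartesian_product[symmetric])
  finally show ?thesis using assms by (simp add: sum_distrib_left)
qed

lemma num_blowup:
  "g > 0 \<Longrightarrow> num (g * n) (\<lambda>x. u (x div g)) = of_int g * num n u"
  unfolding num_def by (rule sum_div[of g "\<lambda>y. of_bool (u y)"])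

text \<open>Colour changes occur only at multiples of \<open>g\<close>, so their number is bounded
  independently of \<open>g\<close>.\<close>

lemma corner_blowup:
  fixes g n :: int
  assumes "g > 0" "n \<ge> 0"
  shows "num (g * n) (corner (\<lambda>x. u (x div g))) \<le> of_int n"
proof -
  have "{0..<g*n} \<inter> {x. corner (\<lambda>x. u (x div g)) x} \<subseteq> (*) g ` {0..<n}"
  proof safe
    fix x assume x: "x \<in> {0..<g*n}" and c: "corner (\<lambda>x. u (x div g)) x"
    have "x mod g = 0"
    proof (rule ccontr)
      assume "x mod g \<noteq> 0"
      hence r: "x mod g \<ge> 1" "x mod g < g" using assms pos_mod_sign[of g x] pos_mod_bound[of g x] by linarith+
      have "x - 1 = (x mod g - 1) + g * (x div g)" by simp
      hence "(x - 1) div g = (x mod g - 1 + g * (x div g)) div g" by (rule arg_cong)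
      also have "\<dots> = x div g + (x mod g - 1) div g" using assms by (intro div_mult_self2) auto
      also have "(x mod g - 1) div g = 0" using r by (intro div_pos_pos_trivial) auto
      finally show False using c by (simp add: corner_def)
    qed
    hence eq: "x = g * (x div g)" by auto
    have "0 \<le> g * (x div g)" "g * (x div g) < g * n" using x eq by auto
    hence "0 \<le> x div g" "x div g < n" using assms by (auto simp: zero_le_mult_iff mult_less_cancel_left)
    thus "x \<in> (*) g ` {0..<n}" using eq by (intro image_eqI[of _ _ "x div g"]) auto
  qed
  hence "card ({0..<g*n} \<inter> {x. corner (\<lambda>x. u (x div g)) x}) \<le> card ((*) g ` {0..<n})"
    by (intro card_mono) auto
  also have "\<dots> \<le> nat n" using card_image_le[of "{0..<n}" "(*) g"] by simp
  finally show ?thesis using assms by (simp add: num_def)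
qed

text \<open>From any point of a block, distances up to \<open>g * w\<close> cover the next
  \<open>w - 1\<close> blocks completely. The block after these may be cut off and is dropped, hence
  \<open>w - 1\<close>.\<close>

lemma cut_blowup:
  fixes g n w :: int
  assumes g: "g > 0" and w: "w \<ge> 1"
  shows "of_int g ^ 2 * cut n (w - 1) u \<le> cut (g * n) (g * w) (\<lambda>x. u (x div g))"
proof -
  define h where "h y i = (of_bool (u y \<and> \<not> u (y + i)) :: real)" for y i
  have inner: "of_int g * (\<Sum>i\<in>{1..w-1}. h y i) \<le> (\<Sum>j\<in>{1..g*w}. of_bool (u (x div g) \<and> \<not> u ((x + j) div g)))"
    if y: "y = x div g" for x y
  proof -
    define r where "r = x mod g"
    have r: "0 \<le> r" "r < g" "x = g * y + r" using g by (auto simp: r_def y)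
    have "(\<Sum>i\<in>{1..w-1}. h y i) = (\<Sum>i\<in>{0..<w-1}. h y (i + 1))"
      by (rule sum.reindex_bij_witness[of _ "\<lambda>z. z + 1" "\<lambda>z. z - 1"]) auto
    hence "of_int g * (\<Sum>i\<in>{1..w-1}. h y i) = (\<Sum>k\<in>{0..<g*(w-1)}. h y (k div g + 1))"
      using sum_div[OF g, of "\<lambda>i. h y (i + 1)"] by simp
    also have "\<dots> = (\<Sum>j\<in>{g-r..<g-r+g*(w-1)}. of_bool (u (x div g) \<and> \<not> u ((x + j) div g)))"
    proof (rule sum.reindex_bij_witness[of _ "\<lambda>j. j + r - g" "\<lambda>k. k + g - r"])
      fix k assume "k \<in> {0..<g*(w-1)}"
      have "(x + (k + g - r)) div g = (k + g * (y + 1)) div g" using r by (simp add: algebra_simps)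
      also have "\<dots> = y + 1 + k div g" using g by (intro div_mult_self2) auto
      finally show "of_bool (u (x div g) \<and> \<not> u ((x + (k + g - r)) div g)) = h y (k div g + 1)"
        using y by (simp add: h_def add_ac)
    qed (auto simp: algebra_simps)
    also have "\<dots> \<le> (\<Sum>j\<in>{1..g*w}. of_bool (u (x div g) \<and> \<not> u ((x + j) div g)))"
      using r by (intro sum_mono2) (auto simp: algebra_simps)
    finally show ?thesis .
  qed
  have "of_int g ^ 2 * cut n (w - 1) u = of_int g * (of_int g * (\<Sum>y\<in>{0..<n}. \<Sum>i\<in>{1..w-1}. h y i))"
    by (simp add: cut_swap h_def power2_eq_square)
  also have "\<dots> = of_int g * (\<Sum>y\<in>{0..<n}. of_int g * (\<Sum>i\<in>{1..w-1}. h y i))"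
    by (simp only: sum_distrib_left)
  also have "\<dots> = (\<Sum>x\<in>{0..<g*n}. of_int g * (\<Sum>i\<in>{1..w-1}. h (x div g) i))"
    by (rule sum_div[OF g, symmetric])
  also have "\<dots> \<le> cut (g * n) (g * w) (\<lambda>x. u (x div g))"
    unfolding cut_swap by (intro sum_mono inner refl)
  finally show ?thesis .
qed

text \<open>In a \<open>g\<close>-fold blow-up both sides grow like \<open>g\<close> squared but the
  term with \<open>C\<close> only like \<open>g\<close>, so it vanishes in the limit. The summand 1
  next to \<open>w\<close> is the block lost in \<open>cut_blowup\<close>.\<close>

lemma cut_bound:
  fixes \<alpha> \<beta> :: real
  assumes nn: "\<alpha> \<ge> 0" "\<beta> \<ge> 0" and le: "\<alpha> + \<beta> \<le> 1" and quad: "(1 - \<alpha> - \<beta>)\<^sup>2 \<le> 2 * \<alpha> * \<beta>"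
    and per: "periodic n u" and n: "n \<ge> 1" and w: "w \<ge> 0"
  shows "cut n w u \<le> (of_int w + 1) * (\<alpha> * num n u + \<beta> * num n (\<lambda>x. \<not> u x))"
proof -
  let ?a = "num n u" and ?b = "num n (\<lambda>x. \<not> u x)"
  let ?t = "\<alpha> * ?a + \<beta> * ?b"
  have ab: "?a \<ge> 0" "?b \<ge> 0" by (rule num_nonneg)+
  consider "\<alpha> = 0" | "\<beta> = 0" | "\<alpha> > 0" "\<beta> > 0" using nn by linarith
  thus ?thesis
  proof cases
    \<comment> \<open>If one weight is 0, \<open>quad\<close> forces the other to be 1 and a trivial
      count suffices. The theorem meets this case for \<open>k = 0\<close>.\<close>
    case 1
    hence "\<beta> = 1" using quad by simp
    have "cut n w u \<le> (\<Sum>j\<in>{1..w}. ?b)"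
      unfolding cut_def
    proof (rule sum_mono)
      fix j
      have "num n (\<lambda>x. u x \<and> \<not> u (x + j)) \<le> num n (\<lambda>x. \<not> u (x + j))"
        unfolding num_def by (intro sum_mono) auto
      thus "num n (\<lambda>x. u x \<and> \<not> u (x + j)) \<le> ?b"
        using num_shift[OF periodic_compl[OF per], of j] n by simp
    qed
    thus ?thesis using 1 \<open>\<beta> = 1\<close> w ab by (simp add: algebra_simps)
  next
    case 2
    hence "\<alpha> = 1" using quad by simp
    have "cut n w u \<le> (\<Sum>j\<in>{1..w}. ?a)"
      unfolding cut_def num_def by (intro sum_mono) auto
    thus ?thesis using 2 \<open>\<alpha> = 1\<close> w ab by (simp add: algebra_simps)
  next
    case 3
    \<comment> \<open>\<open>n\<close> bounds the colour changes of every blow-up, so one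
      \<open>C\<close> serves all \<open>g\<close>.\<close>
    define C where "C = of_int n / min \<alpha> \<beta>"
    have C: "of_int n \<le> C * \<alpha>" "of_int n \<le> C * \<beta>" "C \<ge> 0"
      using 3 n by (auto simp: C_def field_simps min_def)
    have "cut n w u \<le> (of_int w + 1) * ?t + C * ?t / real g" if g: "g > 0" for g :: nat
    proof -
      let ?v = "\<lambda>x. u (x div int g)"
      have gi: "int g > 0" using g by simp
      have perv: "periodic (int g * n) ?v"
        using per g unfolding periodic_def by (simp add: add.commute[of n])
      have "of_int (int g) ^ 2 * cut n (w + 1 - 1) u \<le> cut (int g * n) (int g * (w + 1)) ?v"
        using w by (intro cut_blowup[OF gi]) auto
      also have "\<dots> \<le> (of_int (int g * (w + 1)) + C) * (\<alpha> * num (int g * n) ?v + \<beta> * num (int g * n) (\<lambda>x. \<not> ?v x))"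
      proof (intro cut_bound_corners[OF 3 le quad C perv] corner_blowup)
        have "int g * n > 0" using gi n by simp
        thus "1 \<le> int g * n" by linarith
      qed (use n w gi in auto)
      also have "\<dots> = (real g * (of_int w + 1) + C) * (real g * ?t)"
        using num_blowup[OF gi, of n u] num_blowup[OF gi, of n "\<lambda>x. \<not> u x"] by (simp add: algebra_simps)
      finally have "real g * real g * cut n w u \<le> real g * (real g * ((of_int w + 1) * ?t) + C * ?t)"
        by (simp add: power2_eq_square algebra_simps)
      hence "real g * cut n w u \<le> real g * ((of_int w + 1) * ?t) + C * ?t"
        using g by (simp add: mult.assoc)
      thus ?thesis using g by (simp add: field_simps)
    qed
    hence ev: "\<forall>\<^sub>F g in sequentially. cut n w u \<le> (of_int w + 1) * ?t + C * ?t / real g"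
      using eventually_gt_at_top[of 0] by (rule eventually_mono[rotated]) auto
    have "(\<lambda>g. (of_int w + 1) * ?t + C * ?t / real g) \<longlonglongrightarrow> (of_int w + 1) * ?t + 0"
      by (intro tendsto_intros lim_const_over_n)
    from tendsto_lowerbound[OF this ev] show ?thesis by simp
  qed
qed

section \<open>From words to fractional weights\<close>

text \<open>A function affine in each coordinate is bounded on the cube by its values at the
  vertices.\<close>

lemma affine_le_zero:
  fixes f :: "('i \<Rightarrow> real) \<Rightarrow> real"
  assumes "finite S"
    and aff: "\<And>\<theta> i x. i \<in> S \<Longrightarrow> f (\<theta>(i := x)) = (1 - x) * f (\<theta>(i := 0)) + x * f (\<theta>(i := 1))"
    and ends: "\<And>\<theta>. (\<forall>i\<in>S. \<theta> i \<in> {0, 1}) \<Longrightarrow> f \<theta> \<le> 0"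
    and \<theta>: "\<forall>i\<in>S. \<theta> i \<in> {0..1}"
  shows "f \<theta> \<le> 0"
proof -
  \<comment> \<open>\<open>T\<close> collects the coordinates already released from
    \<open>{0, 1}\<close> to the whole interval.\<close>
  have "(\<forall>i\<in>S - T. \<theta> i \<in> {0, 1}) \<longrightarrow> (\<forall>i\<in>T. \<theta> i \<in> {0..1}) \<longrightarrow> f \<theta> \<le> 0"
    if "finite T" "T \<subseteq> S" for T \<theta>
    using that
  proof (induction T arbitrary: \<theta> rule: finite_induct)
    case empty
    thus ?case using ends by simp
  next
    case (insert i T)
    show ?case
    proof (intro impI)
      assume H: "\<forall>j\<in>S - insert i T. \<theta> j \<in> {0, 1}" "\<forall>j\<in>insert i T. \<theta> j \<in> {0..1}"
      have c: "f (\<theta>(i := c)) \<le> 0" if "c \<in> {0, 1}" for c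
      proof -
        have "\<forall>j\<in>S - T. (\<theta>(i := c)) j \<in> {0, 1}" using H(1) that by simp
        moreover have "\<forall>j\<in>T. (\<theta>(i := c)) j \<in> {0..1}" using H(2) insert.hyps by auto
        ultimately show ?thesis using insert.IH[of "\<theta>(i := c)"] insert.prems by blast
      qed
      have "f (\<theta>(i := 0)) \<le> 0" "f (\<theta>(i := 1)) \<le> 0" by (rule c, simp)+
      hence "(1 - \<theta> i) * f (\<theta>(i := 0)) + \<theta> i * f (\<theta>(i := 1)) \<le> 0"
        using H(2) by (intro add_nonpos_nonpos mult_nonneg_nonpos) auto
      thus "f \<theta> \<le> 0" using aff[of i \<theta> "\<theta> i"] insert.prems by simp
    qed
  qed
  from this[OF assms(1), of \<theta>] \<theta> show ?thesis by simp
qed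

lemma fractional_cut_bound:
  fixes \<alpha> \<beta> :: real and \<theta> :: "int \<Rightarrow> real"
  assumes nn: "\<alpha> \<ge> 0" "\<beta> \<ge> 0" and le: "\<alpha> + \<beta> \<le> 1" and quad: "(1 - \<alpha> - \<beta>)\<^sup>2 \<le> 2 * \<alpha> * \<beta>"
    and w: "0 \<le> w" "w < n" and \<theta>: "\<forall>i\<in>{0..<n}. \<theta> i \<in> {0..1}"
  shows "(\<Sum>x\<in>{0..<n}. \<Sum>j\<in>{1..w}. \<theta> x * (1 - \<theta> ((x + j) mod n)))
    \<le> (of_int w + 1) * (\<alpha> * (\<Sum>x\<in>{0..<n}. \<theta> x) + \<beta> * (\<Sum>x\<in>{0..<n}. 1 - \<theta> x))"
proof -
  define G where "G \<theta> = (\<Sum>x\<in>{0..<n}. \<Sum>j\<in>{1..w}. \<theta> x * (1 - \<theta> ((x + j) mod n)))" for \<theta> :: "int \<Rightarrow> real"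
  define a where "a \<theta> = (\<Sum>x\<in>{0..<n}. \<theta> x)" for \<theta> :: "int \<Rightarrow> real"
  define b where "b \<theta> = (\<Sum>x\<in>{0..<n}. 1 - \<theta> x)" for \<theta> :: "int \<Rightarrow> real"
  let ?f = "\<lambda>\<theta>. G \<theta> - (of_int w + 1) * (\<alpha> * a \<theta> + \<beta> * b \<theta>)"
  have n: "n \<ge> 1" using w by simp
  \<comment> \<open>Since \<open>w < n\<close>, no product pairs a weight with itself; this makes
    \<open>G\<close> affine in each weight.\<close>
  have ne: "(x + j) mod n \<noteq> x" if "x \<in> {0..<n}" "j \<in> {1..w}" for x j
  proof
    assume "(x + j) mod n = x"
    hence "(x + j) mod n = x mod n" using that by simp
    hence "n dvd j" by (simp add: mod_eq_dvd_iff)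
    thus False using that w zdvd_imp_le[of n j] by auto
  qed
  have "?f \<theta> \<le> 0"
  proof (rule affine_le_zero[of "{0..<n}" ?f])
    fix \<theta> :: "int \<Rightarrow> real" and i x assume i: "i \<in> {0..<n}"
    let ?p = "\<theta>(i := x)" and ?lo = "\<theta>(i := 0)" and ?hi = "\<theta>(i := 1)"
    have mix: "?p y * (1 - ?p z) = (1 - x) * (?lo y * (1 - ?lo z)) + x * (?hi y * (1 - ?hi z))"
      if ne': "z \<noteq> y" for y z
    proof -
      consider "y = i" "z \<noteq> i" | "y \<noteq> i" "z = i" | "y \<noteq> i" "z \<noteq> i" using ne' by blast
      thus ?thesis
      proof cases
        case 3
        thus ?thesis by (simp add: algebra_simps)
      qed simp_all
    qed
    have G: "G ?p = (1 - x) * G ?lo + x * G ?hi"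
      unfolding G_def sum_distrib_left sum.distrib[symmetric]
    proof (intro sum.cong refl)
      fix y j assume yj: "y \<in> {0..<n}" "j \<in> {1..w}"
      show "?p y * (1 - ?p ((y + j) mod n)) = (1 - x) * (?lo y * (1 - ?lo ((y + j) mod n)))
          + x * (?hi y * (1 - ?hi ((y + j) mod n)))"
        using mix[OF ne[OF yj]] .
    qed
    have a: "a ?p = (1 - x) * a ?lo + x * a ?hi"
      unfolding a_def sum_distrib_left sum.distrib[symmetric] by (intro sum.cong refl) (auto simp: algebra_simps)
    have b: "b ?p = (1 - x) * b ?lo + x * b ?hi"
      unfolding b_def sum_distrib_left sum.distrib[symmetric] by (intro sum.cong refl) (auto simp: algebra_simps)
    show "?f ?p = (1 - x) * ?f ?lo + x * ?f ?hi"
      unfolding G a b by (simp add: algebra_simps)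
  next
    fix \<theta> :: "int \<Rightarrow> real" assume H: "\<forall>i\<in>{0..<n}. \<theta> i \<in> {0, 1}"
    define u where "u x \<longleftrightarrow> \<theta> (x mod n) = 1" for x
    have ob: "of_bool (u x) = \<theta> (x mod n)" for x
      using bspec[OF H, of "x mod n"] n by (auto simp: u_def)
    have obn: "of_bool (\<not> u x) = 1 - \<theta> (x mod n)" for x
      using ob[of x] by (auto simp: of_bool_def split: if_splits)
    have "G \<theta> = cut n w u"
      unfolding G_def cut_swap of_bool_conj ob obn by (intro sum.cong refl) simp
    moreover have "a \<theta> = num n u" "b \<theta> = num n (\<lambda>x. \<not> u x)"
      unfolding a_def b_def num_def ob obn by (auto intro!: sum.cong)
    moreover have "periodic n u" by (simp add: periodic_def u_def)
    ultimately show "?f \<theta> \<le> 0"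
      using cut_bound[OF nn le quad _ n w(1), of u] by simp
  qed (use \<theta> in auto)
  thus ?thesis by (simp add: G_def a_def b_def)
qed

section \<open>From words to subsets of the circle\<close>

text \<open>The product of \<open>X\<close> and \<open>Y\<close> in the coordinates start and step
  instead of start and endpoint.\<close>

definition shear :: "real set \<Rightarrow> real set \<Rightarrow> (real \<times> real) set" where
  "shear X Y = {(x, t). x \<in> X \<and> x + t \<in> Y}"

text \<open>Every slice over \<open>x \<in> X\<close> is a translate of \<open>Y\<close>, so Tonelli
  gives the product formula.\<close>

lemma shear_borel:
  assumes [measurable]: "X \<in> sets borel" "Y \<in> sets borel"
  shows "shear X Y \<in> sets borel" "emeasure lborel (shear X Y) = emeasure lborel X * emeasure lborel Y"
proof -
  have "fst \<in> borel_measurable (borel :: (real \<times> real) measure)"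
    and "(\<lambda>p. fst p + snd p) \<in> borel_measurable (borel :: (real \<times> real) measure)"
    by (intro borel_measurable_continuous_onI continuous_intros)+
  hence "fst -` X \<inter> space borel \<in> sets (borel :: (real \<times> real) measure)"
    and "(\<lambda>p. fst p + snd p) -` Y \<inter> space borel \<in> sets (borel :: (real \<times> real) measure)"
    using assms by (auto intro: measurable_sets simp del: space_borel)
  hence "(fst -` X \<inter> space borel) \<inter> ((\<lambda>p. fst p + snd p) -` Y \<inter> space borel) \<in> sets (borel :: (real \<times> real) measure)"
    by (rule sets.Int)
  also have "(fst -` X \<inter> space borel) \<inter> ((\<lambda>p. fst p + snd p) -` Y \<inter> space borel) = shear X Y"
    by (auto simp: shear_def)
  finally show m: "shear X Y \<in> sets borel" .
  have tr: "emeasure lborel {t. x + t \<in> Y} = emeasure lborel Y" for x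
  proof -
    have "emeasure lborel Y = emeasure (distr lborel borel ((+) x)) Y"
      by (simp add: lborel_distr_plus)
    also have "\<dots> = emeasure lborel {t. x + t \<in> Y}"
      by (subst emeasure_distr) (auto simp: vimage_def)
    finally show ?thesis by simp
  qed
  have "emeasure lborel (shear X Y) = emeasure (lborel \<Otimes>\<^sub>M lborel) (shear X Y)"
    by (simp add: lborel_prod)
  also have "\<dots> = (\<integral>\<^sup>+ x. emeasure lborel (Pair x -` shear X Y) \<partial>lborel)"
    using m by (intro lborel.emeasure_pair_measure_alt) (unfold lborel_prod, simp)
  also have "\<dots> = (\<integral>\<^sup>+ x. emeasure lborel Y * indicator X x \<partial>lborel)"
  proof (rule nn_integral_cong)
    fix x
    have "Pair x -` shear X Y = (if x \<in> X then {t. x + t \<in> Y} else {})"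
      by (auto simp: shear_def)
    thus "emeasure lborel (Pair x -` shear X Y) = emeasure lborel Y * indicator X x"
      by (simp add: tr)
  qed
  also have "\<dots> = emeasure lborel X * emeasure lborel Y"
    by (subst nn_integral_cmult_indicator) (auto simp: mult.commute)
  finally show "emeasure lborel (shear X Y) = emeasure lborel X * emeasure lborel Y" .
qed

text \<open>Replacing both sets by Borel sets up to null sets changes the shear only inside
  \<open>shear N' UNIV\<close> and \<open>shear UNIV M'\<close>, which are null by the Borel
  case.\<close>

lemma shear_lebesgue:
  assumes "X \<in> sets lebesgue" "Y \<in> sets lebesgue"
  shows "shear X Y \<in> sets lebesgue"
    and "emeasure lebesgue (shear X Y) = emeasure lebesgue X * emeasure lebesgue Y"
proof -
  obtain S N N' where X: "X = S \<union> N" "N \<subseteq> N'" "N' \<in> null_sets lborel" "S \<in> sets lborel"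
    using sets_completionE[OF assms(1)] by blast
  obtain T M M' where Y: "Y = T \<union> M" "M \<subseteq> M'" "M' \<in> null_sets lborel" "T \<in> sets lborel"
    using sets_completionE[OF assms(2)] by blast
  have null: "Z \<in> null_sets lebesgue" if "Z \<subseteq> Z'" "Z' \<in> null_sets lborel" for Z Z' :: "'b::euclidean_space set"
    using that by (meson null_sets_completion_subset null_sets_completionI)
  have b: "N' \<in> sets borel" "M' \<in> sets borel" "S \<in> sets borel" "T \<in> sets borel"
    using X Y by auto
  have eX: "emeasure lebesgue X = emeasure lborel S"
    using X null[OF X(2,3)] by (simp add: emeasure_Un_null_set)
  have eY: "emeasure lebesgue Y = emeasure lborel T"
    using Y null[OF Y(2,3)] by (simp add: emeasure_Un_null_set)
  define Z where "Z = shear X Y - shear S T"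
  have "Z \<subseteq> shear N' UNIV \<union> shear UNIV M'"
    using X(1,2) Y(1,2) by (auto simp: Z_def shear_def)
  moreover have "shear N' UNIV \<union> shear UNIV M' \<in> null_sets lborel"
  proof (rule null_sets.Un)
    show "shear N' UNIV \<in> null_sets lborel" "shear UNIV M' \<in> null_sets lborel"
      using shear_borel[of N' UNIV] shear_borel[of UNIV M'] b X(3) Y(3) by (auto simp: null_sets_def)
  qed
  ultimately have Z: "Z \<in> null_sets lebesgue" by (rule null)
  have eq: "shear X Y = shear S T \<union> Z"
    using X(1) Y(1) by (auto simp: Z_def shear_def)
  have st: "shear S T \<in> sets lebesgue" using shear_borel(1)[OF b(3,4)] by simp
  thus "shear X Y \<in> sets lebesgue" unfolding eq using Z by auto
  show "emeasure lebesgue (shear X Y) = emeasure lebesgue X * emeasure lebesgue Y"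
    unfolding eX eY unfolding eq using st Z shear_borel[OF b(3,4)] by (simp add: emeasure_Un_null_set)
qed

lemma measure_shear:
  assumes "X \<in> sets lebesgue" "Y \<in> sets lebesgue"
  shows "measure lebesgue (shear X Y) = measure lebesgue X * measure lebesgue Y"
  unfolding measure_def shear_lebesgue(2)[OF assms] by (rule enn2real_mult)

lemma lebesgue_translate:
  fixes Y :: "real set"
  assumes "Y \<in> sets lebesgue"
  shows "{y. y - s \<in> Y} \<in> sets lebesgue" "measure lebesgue {y. y - s \<in> Y} = measure lebesgue Y"
proof -
  have eq: "{y. y - s \<in> Y} = (+) s ` Y"
    by (auto simp: image_iff intro!: bexI[of _ "_ - s"])
  show "{y. y - s \<in> Y} \<in> sets lebesgue"
    unfolding eq using assms by (rule lebesgue_sets_translation)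
  show "measure lebesgue {y. y - s \<in> Y} = measure lebesgue Y"
    unfolding eq by (rule measure_translation)
qed

section \<open>Steps on the circle and its division into cells\<close>

lemma circle_add_eq:
  assumes "L > 0" "x + t - s \<in> {0..<L}" "s = 0 \<or> s = L"
  shows "circle_add L x t = x + t - s"
proof -
  have "(x + t) rmod L = (x + t - s) rmod L"
    using assms(3) rmod_add[of "x + t - L" L L] by auto
  thus ?thesis using assms by (simp add: circle_add_def)
qed

text \<open>As \<open>1 \<le> L\<close>, a step of length at most 1 wraps around at most
  once.\<close>

lemma circle_add_cases:
  assumes L: "L \<ge> 1" and x: "x \<in> {0..<L}" and t: "t \<in> {0..1}"
  shows "circle_add L x t = x + t \<and> x + t < L \<or> circle_add L x t = x + t - L \<and> x + t \<ge> L"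
proof (cases "x + t < L")
  case True
  thus ?thesis using circle_add_eq[of L x t 0] assms by auto
next
  case False
  thus ?thesis using circle_add_eq[of L x t L] assms by auto
qed

text \<open>The set is cut out of two shears, one for direct and one for wrapped steps, by a strip.
  Finite measure is what monotonicity of \<open>measure\<close> requires later.\<close>

lemma Phi_set_lmeasurable:
  assumes L: "L \<ge> 1" and A: "A \<in> sets lebesgue" "A \<subseteq> circle L"
  shows "{(x, t). x \<in> A \<and> t \<in> {0..1} \<and> circle_add L x t \<in> A} \<in> lmeasurable"
proof -
  let ?B = "{y. y - L \<in> A}"
  have eq: "{(x, t). x \<in> A \<and> t \<in> {0..1} \<and> circle_add L x t \<in> A}
      = (shear A A \<union> shear A ?B) \<inter> UNIV \<times> {0..1}"
  proof -
    have key: "circle_add L x t \<in> A \<longleftrightarrow> x + t \<in> A \<or> x + t - L \<in> A" if "x \<in> A" "t \<in> {0..1}" for x t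
    proof -
      have "x \<in> {0..<L}" using that(1) A(2) by (auto simp: circle_def)
      from circle_add_cases[OF L this that(2)] show ?thesis
      proof (elim disjE conjE)
        assume "circle_add L x t = x + t" "x + t < L"
        moreover from this have "x + t - L \<notin> A" using A(2) by (auto simp: circle_def)
        ultimately show ?thesis by simp
      next
        assume "circle_add L x t = x + t - L" "L \<le> x + t"
        moreover from this have "x + t \<notin> A" using A(2) by (auto simp: circle_def)
        ultimately show ?thesis by simp
      qed
    qed
    show ?thesis
    proof (intro set_eqI)
      fix p :: "real \<times> real"
      obtain x t where p: "p = (x, t)" by force
      show "p \<in> {(x, t). x \<in> A \<and> t \<in> {0..1} \<and> circle_add L x t \<in> A}
          \<longleftrightarrow> p \<in> (shear A A \<union> shear A ?B) \<inter> UNIV \<times> {0..1}"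
        using key[of x t] by (simp only: p shear_def mem_Collect_eq prod.case Un_iff Int_iff mem_Times_iff fst_conv snd_conv UNIV_I) blast
    qed
  qed
  have AL: "A \<in> lmeasurable"
    using A by (intro fmeasurableI2[OF lmeasurable_interval(1), of _ 0 L]) (auto simp: circle_def)
  have BL: "?B \<in> lmeasurable"
    using lebesgue_translate(1)[OF A(1), of L] A(2)
    by (intro fmeasurableI2[OF lmeasurable_interval(1), of _ L "2 * L"]) (auto simp: circle_def)
  have f: "shear X Y \<in> lmeasurable" if "X \<in> lmeasurable" "Y \<in> lmeasurable" for X Y
  proof (rule fmeasurableI)
    note XY = fmeasurableD[OF that(1)] fmeasurableD[OF that(2)]
    show "shear X Y \<in> sets lebesgue" by (rule shear_lebesgue(1)[OF XY])
    show "emeasure lebesgue (shear X Y) < \<infinity>"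
      unfolding shear_lebesgue(2)[OF XY] using fmeasurableD2[OF that(1)] fmeasurableD2[OF that(2)]
      by (simp only: ennreal_mult_eq_top_iff infinity_ennreal_def less_top[symmetric] simp_thms)
  qed
  have "closed (UNIV \<times> {0..1} :: (real \<times> real) set)" by (intro closed_Times) auto
  hence "UNIV \<times> {0..1} \<in> sets (lebesgue :: (real \<times> real) measure)"
    by (intro sets_completionI_sets) (simp only: sets_lborel borel_closed)
  thus ?thesis unfolding eq
    using f[OF AL AL] f[OF AL BL] by (intro fmeasurable_Int_fmeasurable fmeasurable.Un)
qed

text \<open>For two cells at index distance between 1 and \<open>w\<close>, all pairs of points of
  \<open>A\<close> have an admissible step, so the full product of measures is counted. Pairs within
  one cell are given up.\<close>

lemma Phi_ge_cells:
  fixes L :: real and n w :: int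
  assumes L: "L \<ge> 1" and A: "A \<in> sets lebesgue" "A \<subseteq> circle L"
    and n: "n \<ge> 1" and w: "0 \<le> w" "(of_int w + 1) * (L / of_int n) \<le> 1"
  defines "d \<equiv> L / of_int n"
  defines "c \<equiv> \<lambda>i. A \<inter> {d * of_int i..<d * (of_int i + 1)}"
  shows "Phi L A \<ge> (\<Sum>x\<in>{0..<n}. \<Sum>j\<in>{1..w}. measure lebesgue (c x) * measure lebesgue (c ((x + j) mod n)))"
proof -
  \<comment> \<open>\<open>s\<close> lifts a wrapped cell by one turn, so that \<open>Y x j\<close>
    sits at its unwrapped position, with index \<open>x + j\<close> on the line.\<close>
  define s where "s x j = (if x + j \<ge> n then L else 0)" for x j
  define Y where "Y x j = {y. y - s x j \<in> c ((x + j) mod n)}" for x j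
  define T where "T = (\<lambda>(x, j). shear (c x) (Y x j))"
  let ?S = "{(x, t). x \<in> A \<and> t \<in> {0..1} \<and> circle_add L x t \<in> A}"
  let ?P = "{0..<n} \<times> {1..w}"
  have d: "d > 0" using L n by (simp add: d_def)
  have dn: "d * of_int n = L" using n by (simp add: d_def)
  have wn: "w < n"
  proof -
    have "(of_int w + 1) * d \<le> d * of_int n" using w(2) L unfolding dn by (simp add: d_def)
    hence "of_int w + 1 \<le> (of_int n :: real)" using d by (simp add: mult.commute)
    thus ?thesis by linarith
  qed
  have c_sets: "c i \<in> sets lebesgue" for i unfolding c_def using A(1) by (intro sets.Int) auto
  have Y_sets: "Y x j \<in> sets lebesgue" for x j
    unfolding Y_def by (rule lebesgue_translate(1)[OF c_sets])
  have cD: "v \<in> c i \<Longrightarrow> v \<in> A \<and> d * of_int i \<le> v \<and> v < d * of_int i + d" for v i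
    by (auto simp: c_def algebra_simps)
  have YD: "y - s x j \<in> A \<and> d * of_int (x + j) \<le> y \<and> y < d * of_int (x + j) + d"
    if "y \<in> Y x j" "(x, j) \<in> ?P" for y x j
  proof (cases "x + j \<ge> n")
    case True
    have "(x + j) mod n = (x + j - n) mod n" by simp
    also have "\<dots> = x + j - n" using True that wn by (intro mod_pos_pos_trivial) auto
    finally have "y - L \<in> c (x + j - n)" using that(1) True by (simp add: Y_def s_def)
    moreover have "d * of_int (x + j - n) = d * of_int (x + j) - L"
      using dn by (simp add: algebra_simps)
    ultimately show ?thesis using cD[of "y - L" "x + j - n"] True by (auto simp: s_def)
  next
    case False
    hence "(x + j) mod n = x + j" using that by (intro mod_pos_pos_trivial) auto
    thus ?thesis using that False cD[of y "x + j"] by (auto simp: Y_def s_def)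
  qed
  have cell_unique: "i = i'" if "d * of_int i \<le> v" "v < d * of_int i + d"
      "d * of_int i' \<le> v" "v < d * of_int i' + d" for v and i i' :: int
  proof -
    have "d * of_int i < d * (of_int i' + 1)" "d * of_int i' < d * (of_int i + 1)"
      using that by (auto simp: algebra_simps)
    hence "(of_int i :: real) < of_int i' + 1" "(of_int i' :: real) < of_int i + 1" using d by auto
    thus ?thesis by linarith
  qed
  have sub: "T p \<subseteq> ?S" if p: "p \<in> ?P" for p
  proof
    fix q assume "q \<in> T p"
    then obtain x j v t where q: "q = (v, t)" "p = (x, j)" "v \<in> c x" "v + t \<in> Y x j"
      by (auto simp: T_def shear_def split: prod.splits)
    note v = cD[OF q(3)] and y = YD[OF q(4) p[unfolded q(2)]]
    have j: "1 \<le> (of_int j :: real)" "(of_int j :: real) \<le> of_int w" using p q(2) by auto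
    \<comment> \<open>Points of cells with indices \<open>j\<close> apart differ by
      \<open>d * (j - 1)\<close> to \<open>d * (j + 1)\<close>, which stays in \<open>{0..1}\<close>
      because \<open>1 \<le> j\<close> and \<open>j \<le> w\<close>.\<close>
    have "t \<ge> d * (of_int j - 1)" "t \<le> d * (of_int j + 1)" using v y by (auto simp: algebra_simps)
    moreover have "d * (of_int j - 1) \<ge> 0" using d j by simp
    moreover have "d * (of_int j + 1) \<le> 1"
    proof -
      have "d * (of_int j + 1) \<le> d * (of_int w + 1)" using d j by simp
      thus ?thesis using w(2) by (simp add: d_def mult.commute)
    qed
    ultimately have t: "t \<in> {0..1}" by auto
    have "circle_add L v t = v + t - s x j"
      using y A(2) L by (intro circle_add_eq) (auto simp: circle_def s_def)
    thus "q \<in> ?S" using q v y t by simp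
  qed
  \<comment> \<open>The start determines \<open>x\<close>, and the unwrapped endpoint determines
    \<open>x + j\<close>.\<close>
  have disj: "disjoint_family_on T ?P"
    unfolding disjoint_family_on_def
  proof (intro ballI impI)
    fix p p' assume p: "p \<in> ?P" "p' \<in> ?P" "p \<noteq> p'"
    show "T p \<inter> T p' = {}"
    proof (rule ccontr)
      assume "\<not> ?thesis"
      then obtain v t x j x' j' where q: "p = (x, j)" "p' = (x', j')" "v \<in> c x" "v \<in> c x'"
        "v + t \<in> Y x j" "v + t \<in> Y x' j'"
        by (auto simp: T_def shear_def split: prod.splits)
      have "x = x'" using cD[OF q(3)] cD[OF q(4)] cell_unique by blast
      moreover have "x + j = x' + j'"
        using YD[OF q(5)] YD[OF q(6)] p q(1,2) cell_unique[of "x + j" "v + t" "x' + j'"] by blast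
      ultimately show False using p(3) q by simp
    qed
  qed
  have c_fin: "c i \<in> lmeasurable" for i
    by (intro fmeasurableI2[OF lmeasurable_interval(1), of _ "d * of_int i" "d * (of_int i + 1)"] c_sets) (auto simp: c_def)
  have Y_fin: "Y x j \<in> lmeasurable" for x j
    by (intro fmeasurableI2[OF lmeasurable_interval(1), of _ "d * of_int ((x + j) mod n) + s x j"
          "d * (of_int ((x + j) mod n) + 1) + s x j"] Y_sets)
       (auto simp: c_def Y_def)
  have T_sets: "T p \<in> sets lebesgue" for p
    by (auto simp: T_def split: prod.splits intro!: shear_lebesgue(1) c_sets Y_sets)
  have T_fin: "emeasure lebesgue (T p) \<noteq> \<infinity>" for p
  proof -
    obtain x j where p: "p = (x, j)" by force
    show ?thesis unfolding p T_def prod.case shear_lebesgue(2)[OF c_sets Y_sets]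
      using fmeasurableD2[OF c_fin[of x]] fmeasurableD2[OF Y_fin[of x j]]
      by (simp only: ennreal_mult_eq_top_iff infinity_ennreal_def simp_thms)
  qed
  have T_meas: "measure lebesgue (T (x, j)) = measure lebesgue (c x) * measure lebesgue (c ((x + j) mod n))" for x j
    unfolding T_def using measure_shear[OF c_sets Y_sets] lebesgue_translate(2)[OF c_sets]
    by (simp add: Y_def)
  have "(\<Sum>x\<in>{0..<n}. \<Sum>j\<in>{1..w}. measure lebesgue (c x) * measure lebesgue (c ((x + j) mod n)))
      = (\<Sum>p\<in>?P. measure lebesgue (T p))"
    by (simp add: sum.cartesian_product T_meas[symmetric] case_prod_unfold)
  also have "\<dots> = measure lebesgue (\<Union>p\<in>?P. T p)"
    using disj T_sets T_fin by (intro measure_finite_Union[symmetric]) auto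
  also have "\<dots> \<le> measure lebesgue ?S"
    using sub T_sets Phi_set_lmeasurable[OF L A] by (intro measure_mono_fmeasurable) auto
  finally show ?thesis by (simp add: Phi_def)
qed

text \<open>The densities of \<open>A\<close> in \<open>n\<close> cells serve as weights in
  \<open>fractional_cut_bound\<close>. The term with \<open>2 * (L / real n)\<close> is the loss
  from rounding the step range to whole cells.\<close>

lemma Phi_ge_discrete:
  fixes L \<alpha> \<beta> :: real and n :: nat
  assumes L: "L \<ge> 1" and A: "A \<in> sets lebesgue" "A \<subseteq> circle L"
    and nn: "\<alpha> \<ge> 0" "\<beta> \<ge> 0" and le: "\<alpha> + \<beta> \<le> 1" and quad: "(1 - \<alpha> - \<beta>)\<^sup>2 \<le> 2 * \<alpha> * \<beta>"
    and n: "real n \<ge> L"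
  defines "a \<equiv> measure lebesgue A"
  shows "Phi L A \<ge> (1 - 2 * (L / real n)) * a - (\<alpha> * a + \<beta> * (L - a))"
proof -
  define d where "d = L / real n"
  define c where "c i = A \<inter> {d * of_int i..<d * (of_int i + 1)}" for i :: int
  define \<theta> where "\<theta> i = measure lebesgue (c i) / d" for i
  \<comment> \<open>The largest \<open>w\<close> with \<open>(w + 1) * d \<le> 1\<close>;
    consequently \<open>w * d\<close> falls short of 1 by less than \<open>2 * d\<close>.\<close>
  define w where "w = \<lfloor>1 / d\<rfloor> - 1"
  have n0: "real n > 0" using n L by simp
  have d: "d > 0" using L n0 by (simp add: d_def)
  have "d \<le> 1" using n n0 by (simp add: d_def)
  have dn: "d * real n = L" using n0 by (simp add: d_def)
  have "1 / d \<ge> 1" using d \<open>d \<le> 1\<close> by simp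
  hence w0: "0 \<le> w" by (simp add: w_def le_floor_iff)
  have "of_int w + 1 \<le> 1 / d" "1 / d < of_int w + 2" unfolding w_def by linarith+
  hence wd: "(of_int w + 1) * d \<le> 1" "of_int w * d \<ge> 1 - 2 * d" using d by (auto simp: field_simps)
  have wn: "w < int n"
  proof -
    have "(of_int w + 1) * d \<le> d * real n" using wd(1) L dn by linarith
    hence "of_int w + 1 \<le> real n" using d by (simp add: mult.commute)
    thus ?thesis by linarith
  qed
  have c_sets: "c i \<in> sets lebesgue" for i unfolding c_def using A(1) by (intro sets.Int) auto
  have c_le: "measure lebesgue (c i) \<le> d" for i
  proof -
    have "measure lebesgue (c i) \<le> measure lebesgue {d * of_int i..d * (of_int i + 1)}"
      by (intro measure_mono_fmeasurable c_sets) (auto simp: c_def)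
    also have "\<dots> = d" using d by (simp add: algebra_simps)
    finally show ?thesis .
  qed
  have \<theta>: "\<forall>i\<in>{0..<int n}. \<theta> i \<in> {0..1}" using c_le d by (auto simp: \<theta>_def)
  have sum\<theta>: "d * (\<Sum>x\<in>{0..<int n}. \<theta> x) = a"
  proof -
    have "d * (\<Sum>x\<in>{0..<int n}. \<theta> x) = (\<Sum>x\<in>{0..<int n}. measure lebesgue (c x))"
      using d by (simp add: \<theta>_def sum_distrib_left)
    also have "\<dots> = measure lebesgue (\<Union>x\<in>{0..<int n}. c x)"
    proof (rule measure_finite_Union[symmetric])
      show "disjoint_family_on c {0..<int n}"
        unfolding disjoint_family_on_def
      proof (intro ballI impI)
        fix i i' :: int assume "i \<noteq> i'"
        show "c i \<inter> c i' = {}"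
        proof (rule ccontr)
          assume "\<not> ?thesis"
          then obtain v where "v \<in> c i" "v \<in> c i'" by auto
          hence "d * of_int i < d * (of_int i' + 1)" "d * of_int i' < d * (of_int i + 1)"
            by (auto simp: c_def)
          hence "(of_int i :: real) < of_int i' + 1" "(of_int i' :: real) < of_int i + 1" using d by auto
          thus False using \<open>i \<noteq> i'\<close> by linarith
        qed
      qed
      have "c i \<in> lmeasurable" for i
        by (intro fmeasurableI2[OF lmeasurable_interval(1), of _ "d * of_int i" "d * (of_int i + 1)"] c_sets) (auto simp: c_def)
      thus "emeasure lebesgue (c i) \<noteq> \<infinity>" for i using fmeasurableD2 by (metis infinity_ennreal_def)
    qed (use c_sets in auto)
    also have "(\<Union>x\<in>{0..<int n}. c x) = A"
    proof (intro equalityI subsetI)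
      fix v assume v: "v \<in> A"
      hence "0 \<le> v" "v < d * real n" using A(2) by (auto simp: circle_def dn)
      hence "0 \<le> v / d" "v / d < real n" using d by (auto simp: field_simps)
      hence "\<lfloor>v / d\<rfloor> \<in> {0..<int n}" by (auto simp: floor_less_iff)
      moreover have "of_int \<lfloor>v / d\<rfloor> * d \<le> v"
        by (rule iffD1[OF pos_le_divide_eq[OF d] of_int_floor_le])
      moreover have "v < (of_int \<lfloor>v / d\<rfloor> + 1) * d"
        by (rule iffD1[OF pos_divide_less_eq[OF d] floor_correct[THEN conjunct2, simplified]])
      ultimately have "v \<in> c \<lfloor>v / d\<rfloor>" "\<lfloor>v / d\<rfloor> \<in> {0..<int n}"
        using v by (auto simp: c_def mult.commute)
      thus "v \<in> (\<Union>x\<in>{0..<int n}. c x)" by blast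
    qed (auto simp: c_def)
    finally show ?thesis by (simp add: a_def)
  qed
  have sum1: "d * (\<Sum>x\<in>{0..<int n}. 1 - \<theta> x) = L - a"
    using sum\<theta> dn by (simp add: sum_subtractf right_diff_distrib)
  have a0: "a \<ge> 0" by (simp add: a_def)
  have La: "L - a \<ge> 0"
    unfolding sum1[symmetric] using \<theta> d by (intro mult_nonneg_nonneg sum_nonneg) auto
  let ?t = "\<alpha> * a + \<beta> * (L - a)"
  have t0: "?t \<ge> 0" using nn a0 La by simp
  let ?G = "\<Sum>x\<in>{0..<int n}. \<Sum>j\<in>{1..w}. \<theta> x * (1 - \<theta> ((x + j) mod int n))"
  have "?G \<le> (of_int w + 1) * (\<alpha> * (\<Sum>x\<in>{0..<int n}. \<theta> x) + \<beta> * (\<Sum>x\<in>{0..<int n}. 1 - \<theta> x))"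
    by (rule fractional_cut_bound[OF nn le quad w0 wn \<theta>])
  hence "d\<^sup>2 * ?G \<le> d\<^sup>2 * ((of_int w + 1) * (\<alpha> * (\<Sum>x\<in>{0..<int n}. \<theta> x) + \<beta> * (\<Sum>x\<in>{0..<int n}. 1 - \<theta> x)))"
    by (intro mult_left_mono) auto
  also have "\<dots> = (of_int w + 1) * d * (\<alpha> * (d * (\<Sum>x\<in>{0..<int n}. \<theta> x)) + \<beta> * (d * (\<Sum>x\<in>{0..<int n}. 1 - \<theta> x)))"
  proof -
    have "d\<^sup>2 * (W * (\<alpha> * s + \<beta> * t)) = W * d * (\<alpha> * (d * s) + \<beta> * (d * t))" for W s t :: real
      by (simp add: power2_eq_square algebra_simps)
    thus ?thesis .
  qed
  also have "\<dots> = (of_int w + 1) * d * ?t" unfolding sum\<theta> sum1 ..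
  also have "\<dots> \<le> 1 * ?t" using wd(1) t0 by (rule mult_right_mono)
  finally have G: "d\<^sup>2 * ?G \<le> ?t" by simp
  \<comment> \<open>All cell pairs up to distance \<open>w\<close> that start in \<open>A\<close>
    are split by whether the end lies in \<open>A\<close>. The first kind is below
    \<open>Phi\<close>, the second is \<open>?G\<close>; the factor \<open>d\<^sup>2\<close> turns
    densities into measures.\<close>
  have "(1 - 2 * d) * a \<le> of_int w * d * a" using wd(2) a0 by (rule mult_right_mono)
  also have "\<dots> = d\<^sup>2 * (\<Sum>x\<in>{0..<int n}. of_int w * \<theta> x)"
    unfolding sum\<theta>[symmetric] by (simp add: power2_eq_square sum_distrib_left[symmetric])
  also have "\<dots> = d\<^sup>2 * ((\<Sum>x\<in>{0..<int n}. \<Sum>j\<in>{1..w}. \<theta> x * \<theta> ((x + j) mod int n)) + ?G)"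
  proof -
    have "(\<Sum>j\<in>{1..w}. \<theta> x * \<theta> ((x + j) mod int n)) + (\<Sum>j\<in>{1..w}. \<theta> x * (1 - \<theta> ((x + j) mod int n)))
        = of_int w * \<theta> x" for x
      using w0 by (simp add: sum.distrib[symmetric] right_diff_distrib)
    thus ?thesis by (simp add: sum.distrib[symmetric])
  qed
  also have "\<dots> = (\<Sum>x\<in>{0..<int n}. \<Sum>j\<in>{1..w}. measure lebesgue (c x) * measure lebesgue (c ((x + j) mod int n))) + d\<^sup>2 * ?G"
    using d by (simp add: distrib_left sum_distrib_left \<theta>_def power2_eq_square)
  also have "\<dots> \<le> Phi L A + ?t"
  proof (intro add_mono G)
    show "(\<Sum>x\<in>{0..<int n}. \<Sum>j\<in>{1..w}. measure lebesgue (c x) * measure lebesgue (c ((x + j) mod int n))) \<le> Phi L A"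
      unfolding c_def d_def
      using n0 w0 wd(1) by (intro order_trans[OF _ Phi_ge_cells[OF L A, of "int n" w]]) (auto simp: d_def)
  qed
  finally show ?thesis by (simp add: d_def)
qed

lemma Phi_ge:
  fixes L \<alpha> \<beta> :: real
  assumes L: "L \<ge> 1" and A: "A \<in> sets lebesgue" "A \<subseteq> circle L"
    and nn: "\<alpha> \<ge> 0" "\<beta> \<ge> 0" and le: "\<alpha> + \<beta> \<le> 1" and quad: "(1 - \<alpha> - \<beta>)\<^sup>2 \<le> 2 * \<alpha> * \<beta>"
  shows "Phi L A \<ge> (1 - \<alpha>) * measure lebesgue A - \<beta> * (L - measure lebesgue A)"
proof -
  let ?a = "measure lebesgue A"
  have "(\<lambda>n. (1 - 2 * (L / real n)) * ?a - (\<alpha> * ?a + \<beta> * (L - ?a)))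
      \<longlonglongrightarrow> (1 - 2 * 0) * ?a - (\<alpha> * ?a + \<beta> * (L - ?a))"
    by (intro tendsto_intros lim_const_over_n)
  moreover have "\<forall>\<^sub>F n in sequentially. Phi L A \<ge> (1 - 2 * (L / real n)) * ?a - (\<alpha> * ?a + \<beta> * (L - ?a))"
    using eventually_ge_at_top[of "nat \<lceil>L\<rceil>"]
  proof eventually_elim
    case (elim n)
    thus ?case using Phi_ge_discrete[OF L A nn le quad, of n] by linarith
  qed
  ultimately have "(1 - 2 * 0) * ?a - (\<alpha> * ?a + \<beta> * (L - ?a)) \<le> Phi L A"
    by (rule tendsto_upperbound) simp
  thus ?thesis by (simp add: algebra_simps)
qed

section \<open>Summation over the classes\<close>

theorem theorem1p1:
  fixes k :: nat and L :: real and A :: "nat \<Rightarrow> real set"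
  assumes "L \<ge> 1"
    and "\<And>i. i \<in> {1..k+1} \<Longrightarrow> A i \<in> sets lebesgue"
    and "disjoint_family_on A {1..k+1}"
    and "(\<Union>i\<in>{1..k+1}. A i) = circle L"
  shows "(\<Sum>i\<in>{1..k+1}. Phi L (A i)) \<ge> (sqrt (real k ^ 2 + 1) - real k) * L"
proof -
  define r where "r = sqrt (real k ^ 2 + 1)"
  have r2: "r\<^sup>2 = real k ^ 2 + 1" by (simp add: r_def)
  have "sqrt (real k ^ 2) \<le> r" "sqrt 1 \<le> r"
    unfolding r_def by (auto simp del: real_sqrt_pow2_iff real_sqrt_abs real_sqrt_one)
  hence rk: "real k \<le> r" "1 \<le> r" by auto
  \<comment> \<open>The point with coordinates \<open>1 / r\<close> and \<open>k / r\<close> lies on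
    the unit circle, which turns \<open>quad\<close> into an equality;
    \<open>\<alpha> + \<beta> \<le> 1\<close> amounts to \<open>r \<le> k + 1\<close>.\<close>
  define \<alpha> \<beta> where "\<alpha> = 1 - 1 / r" and "\<beta> = 1 - real k / r"
  have "r\<^sup>2 \<le> (real k + 1)\<^sup>2" unfolding r2 by (simp add: power2_eq_square algebra_simps)
  hence "r \<le> real k + 1" by (rule power2_le_imp_le) simp
  hence "(1 + real k) / r \<ge> 1" using rk by simp
  hence le: "\<alpha> + \<beta> \<le> 1" by (simp add: \<alpha>_def \<beta>_def add_divide_distrib)
  have nn: "\<alpha> \<ge> 0" "\<beta> \<ge> 0" using rk by (auto simp: \<alpha>_def \<beta>_def)
  have "r\<^sup>2 \<noteq> 0" using rk by simp
  moreover have "(1 / r)\<^sup>2 + (real k / r)\<^sup>2 = (real k ^ 2 + 1) / r\<^sup>2"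
    by (simp add: power_divide add_divide_distrib)
  ultimately have one: "(1 / r)\<^sup>2 + (real k / r)\<^sup>2 = 1" using r2 by (metis divide_self)
  have "(1 - \<alpha> - \<beta>)\<^sup>2 = ((1 / r)\<^sup>2 + (real k / r)\<^sup>2 - 1) + 2 * \<alpha> * \<beta>"
    by (simp add: \<alpha>_def \<beta>_def power2_eq_square algebra_simps)
  hence quad: "(1 - \<alpha> - \<beta>)\<^sup>2 \<le> 2 * \<alpha> * \<beta>" unfolding one by simp
  have sub: "A i \<subseteq> circle L" if "i \<in> {1..k+1}" for i using assms(4) that by blast
  have fin: "A i \<in> lmeasurable" if "i \<in> {1..k+1}" for i
    using assms(2)[OF that] sub[OF that] by (intro fmeasurableI2[OF lmeasurable_interval(1), of _ 0 L]) (auto simp: circle_def)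
  have "(\<Sum>i\<in>{1..k+1}. measure lebesgue (A i)) = measure lebesgue (\<Union>i\<in>{1..k+1}. A i)"
  proof (rule measure_finite_Union[symmetric])
    show "emeasure lebesgue (A i) \<noteq> \<infinity>" if "i \<in> {1..k+1}" for i
      using fmeasurableD2[OF fin[OF that]] by simp
  qed (use assms in auto)
  also have "\<dots> = L" using assms(1,4) by (simp add: circle_def)
  finally have total: "(\<Sum>i\<in>{1..k+1}. measure lebesgue (A i)) = L" .
  \<comment> \<open>The bounds are linear in the measures, so their sum depends only on the total
    \<open>L\<close>, whatever the sizes of the classes. The complements have total measure
    \<open>k * L\<close>.\<close>
  have "(r - real k) * L = (1 - \<alpha>) * L - \<beta> * (real (k + 1) * L - L)"
  proof -
    have "1 / r + real k * (real k / r) = r"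
      using rk r2 by (simp add: field_simps power2_eq_square)
    moreover have "(1 - \<alpha>) * L - \<beta> * (real (k + 1) * L - L) = (1 / r + real k * (real k / r) - real k) * L"
      by (simp add: \<alpha>_def \<beta>_def algebra_simps)
    ultimately show ?thesis by simp
  qed
  also have "\<dots> = (\<Sum>i\<in>{1..k+1}. (1 - \<alpha>) * measure lebesgue (A i) - \<beta> * (L - measure lebesgue (A i)))"
  proof -
    have "(\<Sum>i\<in>{1..k+1}. (1 - \<alpha>) * measure lebesgue (A i) - \<beta> * (L - measure lebesgue (A i)))
        = (1 - \<alpha>) * (\<Sum>i\<in>{1..k+1}. measure lebesgue (A i)) - \<beta> * (real (k + 1) * L - (\<Sum>i\<in>{1..k+1}. measure lebesgue (A i)))"
      by (simp add: sum_subtractf sum_distrib_left[symmetric] del: sum.cl_ivl_Suc)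
    thus ?thesis unfolding total by simp
  qed
  also have "\<dots> \<le> (\<Sum>i\<in>{1..k+1}. Phi L (A i))"
    using assms(1,2) sub by (intro sum_mono Phi_ge nn le quad) auto
  finally show ?thesis by (simp add: r_def)
qed

end
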